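(* Let $a,b$ be positive integers with $1\le a\le b$. Every nonnegative integer can be written as $ax^2+by^2+2(z^2+zw+w^2)$ with $x,y,z,w\in\mathbb{Z}$ if and only if $a=1$ and $b\in\{1,2,3,4,5\}$. *)

theory Defs
  imports Main
begin

end

theory Submission
  imports Defs "HOL-Number_Theory.Number_Theory" "HOL-Computational_Algebra.Squarefree"
    "HOL-Analysis.Infinite_Sum"
begin

text \<open>The values 1 and 5 force \<open>a = 1\<close> and \<open>b \<le> 5\<close>. For the converse it suffices that the ternary form
  \<open>x\<^sup>2 + 2 (z\<^sup>2 + z w + w\<^sup>2)\<close> represents every squarefree \<open>m\<close> prime to 3 with \<open>m mod 8 \<noteq> 5\<close>,
  because \<open>n - b y\<^sup>2\<close> can be brought into this shape up to squares (multiples of 3 with \<open>b = 3\<close> are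
  reduced to sums of four squares instead).

  Such an \<open>m\<close> is the norm of a vector in a positive definite ternary lattice of determinant 3. By
  reduction theory there are only two such lattices, and a residue modulo 9 singles out the right
  one. Writing the lattice down requires a number \<open>c\<close> with prescribed quadratic characters, all of
  whose prime factors \<open>q\<close> satisfy \<open>(-3m / q) = 1\<close>. One would usually take \<open>c\<close> to be a prime given by
  Dirichlet's theorem; here the existence of \<open>c\<close> follows from comparing the growth of the Lambert
  series of convolutions of real characters as \<open>t \<rightarrow> 1\<close>.\<close>

text \<open>The lattice only asks that every prime factor q of c satisfy (-3m / q) = 1, and
  reciprocity writes this symbol as a product chi(q) of the characters that are prescribed for c.
  Primality of c can therefore be replaced by positivity: r(n), the sum of chi over the divisors of
  n, is nonnegative, is at least 1 on squares prime to the modulus, and vanishes as soon as a prime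
  with chi(q) = -1 divides n to an odd power. Any n with the right characters and r(n) > 0 thus has
  a usable squarefree part, and squares alone force the divergence as t tends to 1.

  The obstacle is that such a c automatically has chi(c) = 1, which is one relation among the
  prescribed signs. Reciprocity turns it into a condition on m modulo 8. It is met by choosing c
  modulo 4, by a factor 2 in c, or by a factor 2 in m. For m = 5 modulo 8 nothing can help: a value
  x^2 + 2h of this kind needs h = z^2 + z w + w^2 to be 2 modulo 4, whereas an even h has z and w
  even and is divisible by 4.\<close>

section \<open>Divisor sums and Lambert series of real characters\<close>

lemma bij_betw_divisors_coprime_mult:
  fixes a b :: nat
  assumes "coprime a b"
  shows "bij_betw (\<lambda>(x, y). x * y) ({d. d dvd a} \<times> {d. d dvd b}) {d. d dvd a * b}"
proof (rule bij_betw_imageI)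
  show "inj_on (\<lambda>(x, y). x * y) ({d. d dvd a} \<times> {d. d dvd b})"
  proof (rule inj_onI, clarify)
    fix x y x' y' assume d: "x dvd a" "x' dvd a" "y dvd b" "y' dvd b" and eq: "x * y = x' * y'"
    have "coprime x y'" "coprime x' y" "coprime y x'" "coprime y' x"
      using d assms coprime_divisors by (metis coprime_commute)+
    hence "x dvd x'" "x' dvd x" "y dvd y'" "y' dvd y"
      using eq by (metis coprime_dvd_mult_left_iff coprime_dvd_mult_right_iff dvd_triv_left dvd_triv_right)+
    thus "x = x' \<and> y = y'" by (simp add: dvd_antisym)
  qed
  show "(\<lambda>(x, y). x * y) ` ({d. d dvd a} \<times> {d. d dvd b}) = {d. d dvd a * b}"
  proof (intro equalityI subsetI)
    fix d assume "d \<in> {d. d dvd a * b}"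
    then obtain x y where "d = x * y" "x dvd a" "y dvd b"
      using division_decomp[of d a b] by blast
    thus "d \<in> (\<lambda>(x, y). x * y) ` ({d. d dvd a} \<times> {d. d dvd b})" by auto
  qed (auto simp: mult_dvd_mono)
qed

locale real_character =
  fixes \<xi> :: "nat \<Rightarrow> real"
  assumes mult: "\<xi> (a * b) = \<xi> a * \<xi> b"
    and value_cases: "\<xi> a \<in> {-1, 0, 1}"
    and one: "\<xi> 1 = 1"
begin

text \<open>These are the coefficients of zeta(s) L(s, \<xi>); for the character of a quadratic
  field they count the ideals of norm n.\<close>

definition divisor_sum :: "nat \<Rightarrow> real" where
  "divisor_sum n = (\<Sum>d | d dvd n. \<xi> d)"

lemma divisor_sum_mult:
  assumes "coprime a b"
  shows "divisor_sum (a * b) = divisor_sum a * divisor_sum b"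
proof -
  have "divisor_sum (a * b) = (\<Sum>(x, y)\<in>{d. d dvd a} \<times> {d. d dvd b}. \<xi> (x * y))"
    unfolding divisor_sum_def
    by (subst sum.reindex_bij_betw[OF bij_betw_divisors_coprime_mult[OF assms], symmetric])
       (simp add: case_prod_unfold)
  also have "\<dots> = divisor_sum a * divisor_sum b"
    by (simp add: divisor_sum_def mult sum_product sum.cartesian_product)
  finally show ?thesis .
qed

lemma power: "\<xi> (a ^ k) = \<xi> a ^ k"
  by (induction k) (use one mult in auto)

lemma divisor_sum_prime_power:
  assumes "prime p"
  shows "divisor_sum (p ^ k) = (\<Sum>i\<le>k. \<xi> p ^ i)"
proof -
  have "{d. d dvd p ^ k} = (\<lambda>i. p ^ i) ` {..k}"
    using assms by (auto simp: divides_primepow_nat)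
  moreover have "inj_on (\<lambda>i. p ^ i) {..k}"
    using prime_gt_1_nat[OF assms] by (auto intro: inj_onI)
  ultimately show ?thesis
    by (simp add: divisor_sum_def sum.reindex power)
qed

text \<open>The geometric sum is k + 1, 1, or the indicator of even k, according as
  \<open>\<xi> p\<close> is 1, 0 or -1.\<close>

lemma divisor_sum_prime_power_nonneg:
  assumes "prime p"
  shows "divisor_sum (p ^ k) \<ge> 0"
    and "even k \<Longrightarrow> divisor_sum (p ^ k) \<ge> 1"
    and "odd k \<Longrightarrow> \<xi> p = -1 \<Longrightarrow> divisor_sum (p ^ k) = 0"
proof -
  have zero: "(\<Sum>i\<le>k. (0::real) ^ i) = 1"
    by (simp add: power_0_left)
  have minus: "(\<Sum>i\<le>k. (-1::real) ^ i) = of_bool (even k)"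
    by (induction k) auto
  show "divisor_sum (p ^ k) \<ge> 0" "even k \<Longrightarrow> divisor_sum (p ^ k) \<ge> 1"
    "odd k \<Longrightarrow> \<xi> p = -1 \<Longrightarrow> divisor_sum (p ^ k) = 0"
    using value_cases[of p] by (auto simp: divisor_sum_prime_power[OF assms] zero minus)
qed

lemma divisor_sum_split:
  assumes "prime p" "n > 0"
  obtains m where "n = p ^ multiplicity p n * m" "\<not> p dvd m" "m > 0"
    "divisor_sum n = divisor_sum (p ^ multiplicity p n) * divisor_sum m"
proof -
  obtain m where m: "n = p ^ multiplicity p n * m" "\<not> p dvd m"
    using multiplicity_decompose'[of n p] assms by (metis not_prime_unit not_gr_zero)
  moreover have "coprime (p ^ multiplicity p n) m"
    using assms m by (simp add: prime_imp_coprime)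
  moreover have "m > 0" using m by (cases m) auto
  ultimately show ?thesis
    using that divisor_sum_mult by metis
qed

lemma divisor_sum_nonneg: "n > 0 \<Longrightarrow> divisor_sum n \<ge> 0"
proof (induction n rule: less_induct)
  case (less n)
  show ?case
  proof (cases "n = 1")
    case True
    thus ?thesis using one by (simp add: divisor_sum_def)
  next
    case False
    then obtain p where p: "prime p" "p dvd n" using prime_factor_nat by blast
    obtain m where m: "n = p ^ multiplicity p n * m" "\<not> p dvd m" "m > 0"
      "divisor_sum n = divisor_sum (p ^ multiplicity p n) * divisor_sum m"
      using divisor_sum_split[OF p(1) less.prems] by blast
    have "m \<noteq> n" using m p by auto
    moreover have "m dvd n" using m by (metis dvd_triv_right)
    ultimately have "m < n" using less.prems by (simp add: dvd_imp_le le_neq_implies_less)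
    thus ?thesis
      using less.IH m divisor_sum_prime_power_nonneg(1)[OF p(1)] by simp
  qed
qed

text \<open>All multiplicities in a square are even, so each prime power contributes a factor at
  least 1. This is the sole source of divergence of the Lambert series later on.\<close>

lemma divisor_sum_square: "n > 0 \<Longrightarrow> divisor_sum (n ^ 2) \<ge> 1"
proof (induction n rule: less_induct)
  case (less n)
  show ?case
  proof (cases "n = 1")
    case True
    thus ?thesis using one by (simp add: divisor_sum_def)
  next
    case False
    then obtain p where p: "prime p" "p dvd n" using prime_factor_nat by blast
    obtain m where m: "n = p ^ multiplicity p n * m" "\<not> p dvd m" "m > 0"
      using divisor_sum_split[OF p(1) less.prems] by blast
    have "m \<noteq> n" using m p by auto
    moreover have "m dvd n" using m by (metis dvd_triv_right)
    ultimately have "m < n" using less.prems by (simp add: dvd_imp_le le_neq_implies_less)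
    hence "divisor_sum (m ^ 2) \<ge> 1" using less.IH m by blast
    moreover have "n ^ 2 = p ^ (2 * multiplicity p n) * m ^ 2"
      by (subst m(1)) (simp add: power_mult_distrib power_mult mult.commute)
    moreover have "coprime (p ^ (2 * multiplicity p n)) (m ^ 2)"
      using p m by (simp add: prime_imp_coprime)
    ultimately have "divisor_sum (n ^ 2) = divisor_sum (p ^ (2 * multiplicity p n)) * divisor_sum (m ^ 2)"
      using divisor_sum_mult by simp
    moreover have "divisor_sum (p ^ (2 * multiplicity p n)) \<ge> 1"
      using divisor_sum_prime_power_nonneg(2)[OF p(1)] by simp
    ultimately show ?thesis
      using \<open>divisor_sum (m ^ 2) \<ge> 1\<close>
        mult_mono[of 1 "divisor_sum (p ^ (2 * multiplicity p n))" 1 "divisor_sum (m ^ 2)"] by simp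
  qed
qed

text \<open>A prime of odd multiplicity with value -1 would contribute a factor 0. This extracts
  information about prime factors from positivity alone.\<close>

lemma divisor_sum_pos_imp:
  assumes "n > 0" "divisor_sum n > 0" "prime q" "odd (multiplicity q n)"
  shows "\<xi> q \<noteq> -1"
proof
  assume "\<xi> q = -1"
  hence "divisor_sum (q ^ multiplicity q n) = 0"
    using divisor_sum_prime_power_nonneg(3) assms by blast
  thus False
    using divisor_sum_split[OF assms(3,1)] assms(2) by fastforce
qed

end

section \<open>Dirichlet convolutions and their Lambert series\<close>

definition dconv :: "(nat \<Rightarrow> real) \<Rightarrow> (nat \<Rightarrow> real) \<Rightarrow> nat \<Rightarrow> real" where
  "dconv \<alpha> \<beta> n = (\<Sum>d | d dvd n. \<alpha> d * \<beta> (n div d))"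

lemma bij_betw_mult_divisor:
  "bij_betw (\<lambda>(d, e). (d * e, d)) ({1..} \<times> {1..}) (SIGMA n:{1..}. {d :: nat. d dvd n})"
  by (rule bij_betwI[where g = "\<lambda>(n, d). (d, n div d)"]) (auto simp: Suc_le_eq elim!: dvdE)

lemma summable_on_geometric:
  fixes t :: real
  assumes "0 \<le> t" "t < 1"
  shows "(\<lambda>n. t ^ n) summable_on A"
proof -
  have "(\<lambda>n. t ^ n) summable_on (UNIV :: nat set)"
    using assms by (intro norm_summable_imp_summable_on) (simp add: summable_geometric)
  thus ?thesis by (rule summable_on_subset_banach) simp
qed

text \<open>Both sides are the double series over pairs (d, e) of
  \<open>\<alpha> d * \<beta> e * t ^ (d * e)\<close>, grouped by the product or by d; absolute
  convergence justifies the regrouping.\<close>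

lemma
  fixes \<alpha> \<beta> :: "nat \<Rightarrow> real"
  assumes \<alpha>: "\<And>n. \<bar>\<alpha> n\<bar> \<le> 1" and \<beta>: "\<And>n. \<bar>\<beta> n\<bar> \<le> 1" and t: "0 < t" "t < 1"
  shows dconv_summable: "(\<lambda>n. dconv \<alpha> \<beta> n * t ^ n) summable_on {1..}" (is ?S)
    and dconv_Lambert_summable: "(\<lambda>d. \<alpha> d * (\<Sum>\<^sub>\<infinity>e\<in>{1..}. \<beta> e * (t ^ d) ^ e)) summable_on {1..}" (is ?S')
    and dconv_Lambert: "(\<Sum>\<^sub>\<infinity>n\<in>{1..}. dconv \<alpha> \<beta> n * t ^ n)
          = (\<Sum>\<^sub>\<infinity>d\<in>{1..}. \<alpha> d * (\<Sum>\<^sub>\<infinity>e\<in>{1..}. \<beta> e * (t ^ d) ^ e))" (is ?E)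
proof -
  define f where "f = (\<lambda>(d, e). \<alpha> d * (\<beta> e * t ^ (d * e)))"
  have "(\<lambda>(d, e). t ^ d * t ^ e) summable_on ({1..} \<times> {1..} :: (nat \<times> nat) set)"
  proof (rule summable_on_SigmaI)
    fix d :: nat
    show "((\<lambda>e. case (d, e) of (d, e) \<Rightarrow> t ^ d * t ^ e) has_sum (t ^ d * (\<Sum>\<^sub>\<infinity>e\<in>{1..}. t ^ e))) {1..}"
      using has_sum_infsum[OF summable_on_geometric[of t "{1..}"]] t
      by (auto intro: has_sum_cmult_right)
  next
    show "(\<lambda>d. t ^ d * (\<Sum>\<^sub>\<infinity>e\<in>{1..}. t ^ e)) summable_on {1..}"
      using t by (intro summable_on_cmult_left summable_on_geometric) auto
  qed (use t in auto)
  hence "(\<lambda>x. (1 / t) * (case x of (d, e) \<Rightarrow> t ^ d * t ^ e)) summable_on ({1..} \<times> {1..} :: (nat \<times> nat) set)"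
    by (rule summable_on_cmult_right)
  hence "f abs_summable_on {1..} \<times> {1..}"
  proof (rule abs_summable_on_comparison_test')
    fix x :: "nat \<times> nat" assume "x \<in> {1..} \<times> {1..}"
    then obtain d e where x: "x = (d, e)" "d \<ge> 1" "e \<ge> 1" by auto
    obtain d' e' where de: "d = Suc d'" "e = Suc e'"
      using x by (metis One_nat_def Suc_le_D)
    have "norm (f x) = \<bar>\<alpha> d\<bar> * \<bar>\<beta> e\<bar> * t ^ (d * e)"
      using t by (simp add: f_def x abs_mult)
    also have "\<dots> \<le> 1 * 1 * t ^ (d * e)"
      using \<alpha> \<beta> t by (intro mult_mono) auto
    \<comment> \<open>For d, e at least 1, d e is at least d + e - 1; the lost 1 is the factor 1/t
      in the majorant.\<close>
    also have "\<dots> \<le> t ^ (d + e' )"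
      using t by (simp add: de power_decreasing)
    also have "\<dots> = (1 / t) * (t ^ d * t ^ e)"
      using t by (simp add: de power_add)
    finally show "norm (f x) \<le> (1 / t) * (case x of (d, e) \<Rightarrow> t ^ d * t ^ e)"
      by (simp add: x)
  qed
  hence f: "f summable_on {1..} \<times> {1..}"
    by (rule abs_summable_summable)
  define g where "g = (\<lambda>(n, d). \<alpha> d * \<beta> (n div d) * t ^ n)"
  have fg: "f x = g (case x of (d, e) \<Rightarrow> (d * e, d))" if "x \<in> {1..} \<times> {1..}" for x
    using that by (auto simp: f_def g_def)
  have g: "g summable_on (SIGMA n:{1..}. {d. d dvd n})"
    using f by (subst summable_on_reindex_bij_betw[OF bij_betw_mult_divisor, symmetric])
      (subst summable_on_cong[OF fg, symmetric], auto)
  have inner: "(\<Sum>\<^sub>\<infinity>d | d dvd n. g (n, d)) = dconv \<alpha> \<beta> n * t ^ n" if "n \<in> {1..}" for n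
    using that by (simp add: infsum_finite g_def dconv_def sum_distrib_right)
  have "(\<lambda>n. \<Sum>\<^sub>\<infinity>d | d dvd n. g (n, d)) summable_on {1..}"
    using g by (intro summable_on_Sigma_banach) simp
  thus ?S
    by (subst (asm) summable_on_cong[OF inner])
  have inner': "(\<Sum>\<^sub>\<infinity>e\<in>{1..}. f (d, e)) = \<alpha> d * (\<Sum>\<^sub>\<infinity>e\<in>{1..}. \<beta> e * (t ^ d) ^ e)" for d
    by (simp add: f_def infsum_cmult_right' power_mult)
  show ?S'
    using summable_on_Sigma_banach[of "\<lambda>d e. f (d, e)" "{1..}" "\<lambda>_. {1..}"] f
    unfolding inner' by simp
  have "(\<Sum>\<^sub>\<infinity>n\<in>{1..}. dconv \<alpha> \<beta> n * t ^ n) = infsum g (SIGMA n:{1..}. {d. d dvd n})"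
    unfolding infsum_Sigma_banach[OF g, symmetric] by (intro infsum_cong inner[symmetric])
  also have "\<dots> = infsum f ({1..} \<times> {1..})"
    by (subst infsum_reindex_bij_betw[OF bij_betw_mult_divisor, symmetric])
       (intro infsum_cong, use fg in auto)
  also have "\<dots> = (\<Sum>\<^sub>\<infinity>d\<in>{1..}. \<Sum>\<^sub>\<infinity>e\<in>{1..}. f (d, e))"
    using infsum_Sigma_banach[OF f] by simp
  finally show ?E unfolding inner' .
qed

section \<open>Uniform bounds as t tends to 1\<close>

lemma summation_by_parts:
  fixes \<alpha> G :: "nat \<Rightarrow> real"
  shows "(\<Sum>k=1..n. \<alpha> k * G k)
       = (\<Sum>k=1..n. \<alpha> k) * G n + (\<Sum>k=1..<n. (\<Sum>j=1..k. \<alpha> j) * (G k - G (Suc k)))"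
proof (induction n)
  case (Suc n)
  thus ?case by (cases n) (simp_all add: algebra_simps)
qed simp

lemma Abel_bound:
  fixes \<alpha> G :: "nat \<Rightarrow> real"
  assumes "\<And>n. \<bar>\<Sum>k=1..n. \<alpha> k\<bar> \<le> C"
  shows "\<bar>\<Sum>k=1..n. \<alpha> k * G k\<bar> \<le> C * (\<bar>G n\<bar> + (\<Sum>k=1..<n. \<bar>G k - G (Suc k)\<bar>))"
proof -
  have "\<bar>\<Sum>k=1..n. \<alpha> k * G k\<bar>
      \<le> \<bar>(\<Sum>k=1..n. \<alpha> k) * G n\<bar> + \<bar>\<Sum>k=1..<n. (\<Sum>j=1..k. \<alpha> j) * (G k - G (Suc k))\<bar>"
    unfolding summation_by_parts by (rule abs_triangle_ineq)
  also have "\<bar>(\<Sum>k=1..n. \<alpha> k) * G n\<bar> \<le> C * \<bar>G n\<bar>"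
    unfolding abs_mult by (intro mult_right_mono assms) auto
  also have "\<bar>\<Sum>k=1..<n. (\<Sum>j=1..k. \<alpha> j) * (G k - G (Suc k))\<bar> \<le> (\<Sum>k=1..<n. C * \<bar>G k - G (Suc k)\<bar>)"
    by (rule order_trans[OF sum_abs], rule sum_mono)
       (unfold abs_mult, intro mult_right_mono assms, auto)
  finally show ?thesis
    by (simp add: sum_distrib_left distrib_left)
qed

text \<open>Complete periods cancel, leaving at most N terms of size at most 1.\<close>

lemma periodic_partial_sum_bound:
  fixes f :: "nat \<Rightarrow> real"
  assumes "\<And>n. f (n + N) = f n" "(\<Sum>k=1..N. f k) = 0" "\<And>n. \<bar>f n\<bar> \<le> 1" "N > 0"
  shows "\<bar>\<Sum>k=1..n. f k\<bar> \<le> N"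
proof (induction n rule: less_induct)
  case (less n)
  show ?case
  proof (cases "n \<le> N")
    case True
    have "\<bar>\<Sum>k=1..n. f k\<bar> \<le> (\<Sum>k=1..n. 1)"
      by (rule order_trans[OF sum_abs], rule sum_mono) (rule assms)
    thus ?thesis using True by simp
  next
    case False
    then obtain m where n: "n = m + N" by (metis add.commute le_Suc_ex nat_le_linear)
    have "(\<Sum>k=1..n. f k) = (\<Sum>k=1..N. f k) + (\<Sum>k=N+1..N+m. f k)"
      unfolding n add.commute[of m] by (rule sum.ub_add_nat) simp
    also have "(\<Sum>k=N+1..N+m. f k) = (\<Sum>k=1..m. f (k + N))"
      by (subst sum.shift_bounds_cl_nat_ivl[symmetric]) (simp add: add.commute)
    finally have "(\<Sum>k=1..n. f k) = (\<Sum>k=1..m. f k)"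
      using assms by simp
    thus ?thesis using less[of m] n assms(4) by simp
  qed
qed

lemma poly_sum_Lipschitz:
  fixes c :: "nat \<Rightarrow> real"
  assumes "0 \<le> u" "u \<le> 1" "0 \<le> v" "v \<le> 1"
  shows "\<bar>(\<Sum>e\<in>A. c e * u ^ e) - (\<Sum>e\<in>A. c e * v ^ e)\<bar> \<le> (\<Sum>e\<in>A. \<bar>c e\<bar> * e) * \<bar>u - v\<bar>"
proof -
  have "(\<Sum>e\<in>A. c e * u ^ e) - (\<Sum>e\<in>A. c e * v ^ e) = (\<Sum>e\<in>A. c e * (u ^ e - v ^ e))"
    by (simp add: sum_subtractf right_diff_distrib)
  also have "\<bar>\<dots>\<bar> \<le> (\<Sum>e\<in>A. \<bar>c e\<bar> * (e * \<bar>u - v\<bar>))"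
  proof (rule order_trans[OF sum_abs], rule sum_mono)
    fix e
    have "\<bar>u ^ e - v ^ e\<bar> \<le> e * \<bar>u - v\<bar>"
      using norm_power_diff[of u v e] assms by simp
    thus "\<bar>c e * (u ^ e - v ^ e)\<bar> \<le> \<bar>c e\<bar> * (e * \<bar>u - v\<bar>)"
      unfolding abs_mult by (intro mult_left_mono) auto
  qed
  finally show ?thesis
    by (simp add: sum_distrib_right mult.assoc)
qed

lemma periodic_power_series:
  fixes f :: "nat \<Rightarrow> real"
  assumes "\<And>n. f (n + N) = f n" "\<And>n. \<bar>f n\<bar> \<le> 1" "0 \<le> u" "u < 1"
  shows "(\<Sum>\<^sub>\<infinity>e\<in>{1..}. f e * u ^ e) * (1 - u ^ N) = (\<Sum>e=1..N. f e * u ^ e)"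
proof -
  have "(\<lambda>e. f e * u ^ e) abs_summable_on {1..}"
  proof (rule abs_summable_on_comparison_test'[OF summable_on_geometric[of u]])
    fix e :: nat
    have "\<bar>f e\<bar> * u ^ e \<le> 1 * u ^ e"
      using assms by (intro mult_right_mono) auto
    thus "norm (f e * u ^ e) \<le> u ^ e"
      using assms by (simp add: abs_mult)
  qed (use assms in auto)
  hence s: "(\<lambda>e. f e * u ^ e) summable_on {1..}" by (rule abs_summable_summable)
  have U: "{1..} = {1..N} \<union> {N+1..}" by auto
  have "(\<Sum>\<^sub>\<infinity>e\<in>{1..}. f e * u ^ e) = (\<Sum>\<^sub>\<infinity>e\<in>{1..N}. f e * u ^ e) + (\<Sum>\<^sub>\<infinity>e\<in>{N+1..}. f e * u ^ e)"
    unfolding U by (rule infsum_Un_disjoint)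
      (use s in \<open>auto intro: summable_on_subset_banach\<close>)
  also have "(\<Sum>\<^sub>\<infinity>e\<in>{N+1..}. f e * u ^ e) = (\<Sum>\<^sub>\<infinity>e\<in>{1..}. f (e + N) * u ^ (e + N))"
  proof -
    have "bij_betw (\<lambda>e. e + N) {1..} {N+1..}"
      by (rule bij_betwI[where g = "\<lambda>e. e - N"]) auto
    from infsum_reindex_bij_betw[OF this, of "\<lambda>e. f e * u ^ e"] show ?thesis by simp
  qed
  also have "\<dots> = (\<Sum>\<^sub>\<infinity>e\<in>{1..}. u ^ N * (f e * u ^ e))"
    by (simp add: assms(1) power_add mult_ac)
  also have "\<dots> = u ^ N * (\<Sum>\<^sub>\<infinity>e\<in>{1..}. f e * u ^ e)"
    by (rule infsum_cmult_right') 
  finally show ?thesis by (simp add: algebra_simps)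
qed

text \<open>Since the coefficients of a period sum to 0, the factor \<open>1 - u\<close> cancels in
  \<open>(\<Sum>e=1..N. f e * u ^ e) / (1 - u ^ N)\<close>.\<close>

lemma periodic_power_series_Lipschitz:
  fixes f :: "nat \<Rightarrow> real"
  assumes per: "\<And>n. f (n + N) = f n" and sum0: "(\<Sum>k=1..N. f k) = 0"
    and bound: "\<And>n. \<bar>f n\<bar> \<le> 1" and N: "N > 0"
  obtains K where "K \<ge> 0" "\<And>u v. 0 \<le> u \<Longrightarrow> u < 1 \<Longrightarrow> 0 \<le> v \<Longrightarrow> v < 1 \<Longrightarrow>
    \<bar>(\<Sum>\<^sub>\<infinity>e\<in>{1..}. f e * u ^ e) - (\<Sum>\<^sub>\<infinity>e\<in>{1..}. f e * v ^ e)\<bar> \<le> K * \<bar>u - v\<bar>"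
proof -
  define g where "g = (\<lambda>u. \<Sum>\<^sub>\<infinity>e\<in>{1..}. f e * u ^ e)"
  define B where "B = (\<lambda>e. \<Sum>k=1..e. f k)"
  define H where "H = (\<lambda>u::real. \<Sum>e=1..N. B e * u ^ e)"
  define W where "W = (\<lambda>u::real. \<Sum>e<N. 1 * u ^ e)"
  define KH KW M where "KH = (\<Sum>e=1..N. \<bar>B e\<bar> * e)" and "KW = (\<Sum>e<N. \<bar>1::real\<bar> * e)"
    and "M = (\<Sum>e=1..N. \<bar>B e\<bar>)"
  \<comment> \<open>Partial summation pulls out the factor 1 - u. At n = N the boundary term
    vanishes because \<open>B N = 0\<close>.\<close>
  have telescope: "(\<Sum>e=1..n. f e * u ^ e) = (1 - u) * (\<Sum>e=1..n. B e * u ^ e) + B n * u ^ Suc n" for n u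
    by (induction n) (simp_all add: B_def algebra_simps)
  have gW: "g u * W u = H u" if u: "0 \<le> u" "u < 1" for u
  proof -
    have "g u * (1 - u ^ N) = (1 - u) * H u"
      using periodic_power_series[of f N u, OF per bound u] telescope[of u N] sum0
      by (simp add: g_def H_def B_def)
    moreover have "1 - u ^ N = (1 - u) * W u"
      by (simp add: W_def one_diff_power_eq)
    ultimately have "(1 - u) * (g u * W u) = (1 - u) * H u" by (simp add: mult_ac)
    thus ?thesis using u by simp
  qed
  have W1: "W u \<ge> 1" if "0 \<le> u" for u
  proof -
    have "W u = 1 + (\<Sum>e\<in>{..<N} - {0}. u ^ e)"
      unfolding W_def using N by (subst sum.remove[of _ 0]) auto
    moreover have "(\<Sum>e\<in>{..<N} - {0}. u ^ e) \<ge> 0"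
      using that by (intro sum_nonneg) auto
    ultimately show ?thesis by simp
  qed
  have g_bound: "\<bar>g u\<bar> \<le> M" if u: "0 \<le> u" "u < 1" for u
  proof -
    have "\<bar>g u\<bar> * 1 \<le> \<bar>g u\<bar> * W u"
      using W1[OF u(1)] by (intro mult_left_mono) auto
    also have "\<dots> = \<bar>H u\<bar>"
      using gW[OF u] W1[OF u(1)] by (metis abs_mult abs_of_nonneg order_trans zero_le_one)
    also have "\<dots> \<le> (\<Sum>e=1..N. \<bar>B e * u ^ e\<bar>)"
      unfolding H_def by (rule sum_abs)
    also have "\<dots> \<le> (\<Sum>e=1..N. \<bar>B e\<bar> * 1)"
      unfolding abs_mult using u by (intro sum_mono mult_left_mono) (auto simp: power_le_one)
    finally show ?thesis by (simp add: M_def)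
  qed
  have KH: "\<bar>H u - H v\<bar> \<le> KH * \<bar>u - v\<bar>" if "0 \<le> u" "u < 1" "0 \<le> v" "v < 1" for u v
    unfolding H_def KH_def using that by (intro poly_sum_Lipschitz) auto
  have KW: "\<bar>W u - W v\<bar> \<le> KW * \<bar>u - v\<bar>" if "0 \<le> u" "u < 1" "0 \<le> v" "v < 1" for u v
    unfolding W_def KW_def using that by (intro poly_sum_Lipschitz) auto
  have nonneg: "KH \<ge> 0" "KW \<ge> 0" "M \<ge> 0"
    by (auto simp: KH_def KW_def M_def intro!: sum_nonneg)
  show ?thesis
  proof (rule that[of "KH + M * KW"])
    fix u v :: real assume u: "0 \<le> u" "u < 1" and v: "0 \<le> v" "v < 1"
    have "\<bar>g u - g v\<bar> * 1 \<le> \<bar>g u - g v\<bar> * W u"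
      using W1[OF u(1)] by (intro mult_left_mono) auto
    also have "\<dots> = \<bar>(g u - g v) * W u\<bar>"
      using W1[OF u(1)] by (simp add: abs_mult)
    \<comment> \<open>The difference of the quotients H/W, cleared of the denominator at u. Since W
      is at least 1, Lipschitz bounds for the polynomials H and W carry over to g.\<close>
    also have "(g u - g v) * W u = (H u - H v) - g v * (W u - W v)"
      using gW[OF u] gW[OF v] by (simp add: algebra_simps)
    also have "\<bar>\<dots>\<bar> \<le> \<bar>H u - H v\<bar> + \<bar>g v\<bar> * \<bar>W u - W v\<bar>"
      unfolding abs_mult[symmetric] by (rule abs_triangle_ineq4)
    also have "\<dots> \<le> KH * \<bar>u - v\<bar> + M * (KW * \<bar>u - v\<bar>)"
      using u v nonneg by (intro add_mono KH mult_mono KW g_bound) auto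
    finally show "\<bar>(\<Sum>\<^sub>\<infinity>e\<in>{1..}. f e * u ^ e) - (\<Sum>\<^sub>\<infinity>e\<in>{1..}. f e * v ^ e)\<bar> \<le> (KH + M * KW) * \<bar>u - v\<bar>"
      by (simp add: g_def algebra_simps)
  qed (use nonneg in simp)
qed

lemma infsum_partial_sums_tendsto:
  fixes f :: "nat \<Rightarrow> real"
  assumes "f summable_on {1..}"
  shows "(\<lambda>n. \<Sum>k=1..n. f k) \<longlonglongrightarrow> infsum f {1..}"
proof -
  have "(f has_sum infsum f {1..}) {1..}" using assms by simp
  hence "((\<lambda>n. if n = 0 then 0 else f n) has_sum infsum f {1..}) UNIV"
    by (subst has_sum_cong_neutral[where S = UNIV and T = "{1..}" and g = f]) auto
  hence "(\<lambda>n. if n = 0 then 0 else f n) sums infsum f {1..}"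
    by (rule has_sum_imp_sums)
  hence "(\<lambda>n. \<Sum>k\<le>n. if k = 0 then 0 else f k) \<longlonglongrightarrow> infsum f {1..}"
    by (simp add: sums_def_le)
  moreover have "(\<Sum>k\<le>n. if k = 0 then 0 else f k) = (\<Sum>k=1..n. f k)" for n
    by (rule sum.mono_neutral_cong_right) auto
  ultimately show ?thesis by simp
qed

text \<open>In Lambert form the series is the sum of \<open>\<alpha> d * g (t ^ d)\<close> with g
  Lipschitz on [0, 1). As d grows, t^d decreases within [0, 1], so the weights g(t^d) have total
  variation at most K whatever t is, while \<open>\<alpha>\<close> has bounded partial sums.\<close>

lemma dconv_Abel_bounded:
  fixes \<alpha> \<beta> :: "nat \<Rightarrow> real"
  assumes "\<And>n. \<alpha> (n + N) = \<alpha> n" "(\<Sum>k=1..N. \<alpha> k) = 0" "\<And>n. \<bar>\<alpha> n\<bar> \<le> 1"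
    and "\<And>n. \<beta> (n + N) = \<beta> n" "(\<Sum>k=1..N. \<beta> k) = 0" "\<And>n. \<bar>\<beta> n\<bar> \<le> 1" and N: "N > 0"
  obtains C where "\<And>t. 0 < t \<Longrightarrow> t < 1 \<Longrightarrow> \<bar>\<Sum>\<^sub>\<infinity>n\<in>{1..}. dconv \<alpha> \<beta> n * t ^ n\<bar> \<le> C"
proof -
  define g where "g = (\<lambda>u. \<Sum>\<^sub>\<infinity>e\<in>{1..}. \<beta> e * u ^ e)"
  obtain K where K: "K \<ge> 0" "\<And>u v. 0 \<le> u \<Longrightarrow> u < 1 \<Longrightarrow> 0 \<le> v \<Longrightarrow> v < 1 \<Longrightarrow> \<bar>g u - g v\<bar> \<le> K * \<bar>u - v\<bar>"
    unfolding g_def using periodic_power_series_Lipschitz[of \<beta> N] assms by metis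
  have g0: "g 0 = 0" unfolding g_def by (intro infsum_0) (auto simp: power_0_left)
  have bound: "\<bar>\<Sum>\<^sub>\<infinity>n\<in>{1..}. dconv \<alpha> \<beta> n * t ^ n\<bar> \<le> N * (2 * K)" if t: "0 < t" "t < 1" for t
  proof -
    have partial: "\<bar>\<Sum>d=1..n. \<alpha> d * g (t ^ d)\<bar> \<le> N * (2 * K)" if "n \<ge> 1" for n
    proof -
      have tp: "0 \<le> t ^ k" "t ^ k \<le> 1" "k \<ge> 1 \<Longrightarrow> t ^ k < 1" for k
        using t by (auto simp: power_le_one power_less_one_iff)
      have "\<bar>g (t ^ n)\<bar> \<le> K * t ^ n"
        using K(2)[of "t ^ n" 0] tp[of n] that by (simp add: g0)
      also have "\<dots> \<le> K * 1"
        using K tp by (intro mult_left_mono) auto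
      finally have 1: "\<bar>g (t ^ n)\<bar> \<le> K" by simp
      have "(\<Sum>k=1..<n. \<bar>g (t ^ k) - g (t ^ Suc k)\<bar>) \<le> (\<Sum>k=1..<n. K * (t ^ k - t ^ Suc k))"
      proof (rule sum_mono)
        fix k assume "k \<in> {1..<n}"
        moreover have "t ^ Suc k \<le> t ^ k" using t by (simp add: mult_left_le_one_le)
        ultimately show "\<bar>g (t ^ k) - g (t ^ Suc k)\<bar> \<le> K * (t ^ k - t ^ Suc k)"
          using K(2)[of "t ^ k" "t ^ Suc k"] tp[of k] tp[of "Suc k"] by (simp del: power_Suc)
      qed
      also have "\<dots> = K * (t ^ 1 - t ^ n)"
        using sum_Suc_diff'[of 1 n "\<lambda>k. - (t ^ k)"] that by (simp add: sum_distrib_left[symmetric])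
      also have "\<dots> \<le> K * 1"
      proof (rule mult_left_mono)
        show "t ^ 1 - t ^ n \<le> 1" using tp(1)[of n] t unfolding power_one_right by linarith
      qed (rule K)
      finally have 2: "(\<Sum>k=1..<n. \<bar>g (t ^ k) - g (t ^ Suc k)\<bar>) \<le> K" by simp
      have "\<bar>\<Sum>d=1..n. \<alpha> d * g (t ^ d)\<bar> \<le> N * (\<bar>g (t ^ n)\<bar> + (\<Sum>k=1..<n. \<bar>g (t ^ k) - g (t ^ Suc k)\<bar>))"
        using periodic_partial_sum_bound[of \<alpha> N] assms by (intro Abel_bound) auto
      also have "\<dots> \<le> N * (K + K)"
        using 1 2 by (intro mult_left_mono add_mono) auto
      finally show ?thesis by simp
    qed
    have "(\<lambda>n. \<bar>\<Sum>d=1..n. \<alpha> d * g (t ^ d)\<bar>) \<longlonglongrightarrow> \<bar>\<Sum>\<^sub>\<infinity>d\<in>{1..}. \<alpha> d * g (t ^ d)\<bar>"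
      using dconv_Lambert_summable[of \<alpha> \<beta> t] assms t unfolding g_def
      by (intro tendsto_rabs infsum_partial_sums_tendsto) auto
    hence "\<bar>\<Sum>\<^sub>\<infinity>d\<in>{1..}. \<alpha> d * g (t ^ d)\<bar> \<le> N * (2 * K)"
      by (rule LIMSEQ_le_const2) (use partial in auto)
    thus ?thesis
      using dconv_Lambert[of \<alpha> \<beta> t] assms t by (simp add: g_def)
  qed
  thus ?thesis using that by blast
qed

section \<open>Numbers with prescribed real characters\<close>

lemma sum_period_shift:
  fixes f :: "nat \<Rightarrow> real"
  assumes "f N = f 0"
  shows "(\<Sum>k=1..N. f k) = (\<Sum>k<N. f k)"
proof -
  have "(\<Sum>k=1..N. f k) = (\<Sum>k<N. f (Suc k))"
    by (rule sum.reindex_bij_witness[of _ Suc "\<lambda>k. k - 1"]) auto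
  also have "\<dots> = (\<Sum>k<N. f k) + (\<Sum>k<N. f (Suc k) - f k)"
    by (simp add: sum_subtractf)
  also have "(\<Sum>k<N. f (Suc k) - f k) = 0"
    using assms by (simp add: sum_lessThan_telescope)
  finally show ?thesis by simp
qed

text \<open>Multiplication by u permutes the residues modulo N and changes the sign of the
  sum.\<close>

lemma nontrivial_character_sum_zero:
  fixes f :: "nat \<Rightarrow> real"
  assumes mult: "\<And>a b. f (a * b) = f a * f b" and per: "\<And>n. f (n + N) = f n"
    and u: "coprime u N" "f u = -1" and N: "N > 0"
  shows "(\<Sum>k=1..N. f k) = 0"
proof -
  have f_mod: "f (a mod N) = f a" for a
  proof -
    have "f (r + q * N) = f r" for r q
      by (induction q) (use per in \<open>auto simp: algebra_simps\<close>, metis per add.assoc add.commute)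
    from this[of "a mod N" "a div N"] show ?thesis by (simp add: mult.commute)
  qed
  have inj: "inj_on (\<lambda>a. (u * a) mod N) {..<N}"
  proof (rule inj_onI)
    fix a b assume ab: "a \<in> {..<N}" "b \<in> {..<N}" and eq: "(u * a) mod N = (u * b) mod N"
    hence "[a = b] (mod N)"
      using u(1) by (simp add: cong_def[symmetric] cong_mult_lcancel_nat)
    thus "a = b" using ab by (simp add: cong_def)
  qed
  moreover have "(\<lambda>a. (u * a) mod N) ` {..<N} = {..<N}"
    using N by (intro card_subset_eq) (auto simp: card_image[OF inj])
  ultimately have "bij_betw (\<lambda>a. (u * a) mod N) {..<N} {..<N}"
    by (simp add: bij_betw_def)
  hence "(\<Sum>k<N. f k) = (\<Sum>k<N. f ((u * k) mod N))"
    by (rule sum.reindex_bij_betw[symmetric])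
  also have "\<dots> = - (\<Sum>k<N. f k)"
    by (simp add: f_mod mult u(2) sum_negf)
  finally have "(\<Sum>k<N. f k) = 0" by simp
  moreover have "f N = f 0" using per[of 0] by simp
  ultimately show ?thesis using sum_period_shift by simp
qed

text \<open>Each of the J terms tends to 1 as t tends to 1 from the left. The exponents are squares
  of numbers that are 1 modulo N, hence of units modulo N.\<close>

lemma sum_powers_squares_unbounded:
  fixes C :: real and N :: nat
  obtains t where "0 < t" "t < 1" "(\<Sum>k<J. t ^ ((k * N + 1)^2)) \<ge> J / 2"
proof -
  have "((\<lambda>t::real. \<Sum>k<J. t ^ ((k * N + 1)^2)) \<longlongrightarrow> (\<Sum>k<J. 1 ^ ((k * N + 1)^2))) (at_left 1)"
    by (intro tendsto_intros)
  hence "((\<lambda>t::real. \<Sum>k<J. t ^ ((k * N + 1)^2)) \<longlongrightarrow> J) (at_left 1)"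
    by simp
  show thesis
  proof (cases "J = 0")
    case True
    thus ?thesis using that[of "1/2"] by simp
  next
    case False
    have "\<forall>\<^sub>F t in at_left (1::real). (\<Sum>k<J. t ^ ((k * N + 1)^2)) > J / 2"
      using False by (intro order_tendstoD(1)[OF \<open>(_ \<longlongrightarrow> real J) _\<close>]) auto
    moreover have "\<forall>\<^sub>F t in at_left (1::real). t \<in> {0<..<1}"
      by (rule eventually_at_left_real) simp
    ultimately have "\<forall>\<^sub>F t in at_left (1::real). t \<in> {0<..<1} \<and> (\<Sum>k<J. t ^ ((k * N + 1)^2)) > J / 2"
      by (rule eventually_conj[rotated])
    then obtain t where "t \<in> {0<..<1::real}" "(\<Sum>k<J. t ^ ((k * N + 1)^2)) > J / 2"
      using eventually_happens'[of "at_left (1::real)"] by (metis (no_types, lifting) trivial_limit_at_left_real)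
    thus ?thesis using that by force
  qed
qed

lemma infsum_finite_sum:
  fixes f :: "'a \<Rightarrow> 'b \<Rightarrow> real"
  assumes "finite A" "\<And>a. a \<in> A \<Longrightarrow> f a summable_on B"
  shows "(\<Sum>\<^sub>\<infinity>b\<in>B. \<Sum>a\<in>A. f a b) = (\<Sum>a\<in>A. \<Sum>\<^sub>\<infinity>b\<in>B. f a b)
    \<and> (\<lambda>b. \<Sum>a\<in>A. f a b) summable_on B"
  using assms
proof (induction A rule: finite_induct)
  case (insert a A)
  hence IH: "(\<Sum>\<^sub>\<infinity>b\<in>B. \<Sum>a\<in>A. f a b) = (\<Sum>a\<in>A. \<Sum>\<^sub>\<infinity>b\<in>B. f a b)"
    "(\<lambda>b. \<Sum>a\<in>A. f a b) summable_on B"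
    by simp_all
  have a: "f a summable_on B" using insert.prems by simp
  show ?case
    using infsum_add[OF a IH(2)] summable_on_add[OF a IH(2)] insert.hyps IH(1) by simp
qed simp

text \<open>The last assumption is a dual basis: each index has a unit at which only its own
  character is -1. It supplies explicit witnesses that products over nonempty index sets are
  nontrivial.\<close>

locale real_characters =
  fixes I :: "'i set" and \<psi> :: "'i \<Rightarrow> nat \<Rightarrow> real" and N :: nat
  assumes finite: "finite I" and N_pos: "N > 0"
    and mult: "i \<in> I \<Longrightarrow> \<psi> i (a * b) = \<psi> i a * \<psi> i b"
    and periodic: "i \<in> I \<Longrightarrow> \<psi> i (a + N) = \<psi> i a"
    and unit: "i \<in> I \<Longrightarrow> coprime a N \<Longrightarrow> \<psi> i a = 1 \<or> \<psi> i a = -1"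
    and independent: "i \<in> I \<Longrightarrow> \<exists>u. coprime u N \<and> \<psi> i u = -1 \<and> (\<forall>j\<in>I - {i}. \<psi> j u = 1)"
begin

text \<open>The single factors may be nonzero at non-units (a character modulo 4 at odd primes
  dividing N), so 0 is imposed there; the empty set then gives the principal character modulo
  N.\<close>

definition char_prod :: "'i set \<Rightarrow> nat \<Rightarrow> real" where
  "char_prod S a = (if coprime a N then \<Prod>i\<in>S. \<psi> i a else 0)"

lemma char_prod_mult: "S \<subseteq> I \<Longrightarrow> char_prod S (a * b) = char_prod S a * char_prod S b"
  unfolding char_prod_def by (auto simp: mult subset_iff simp flip: prod.distrib cong: prod.cong)

lemma char_prod_periodic: "S \<subseteq> I \<Longrightarrow> char_prod S (a + N) = char_prod S a"
  unfolding char_prod_def coprime_iff_gcd_eq_1 gcd_add1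
  by (auto simp: periodic subset_iff cong: prod.cong)

lemma char_prod_unit:
  assumes "S \<subseteq> I" "coprime a N"
  shows "char_prod S a = 1 \<or> char_prod S a = -1"
proof -
  have "finite S" using assms finite by (auto intro: finite_subset)
  hence "(\<Prod>i\<in>S. \<psi> i a) = 1 \<or> (\<Prod>i\<in>S. \<psi> i a) = -1"
    using assms(1)
  proof (induction S rule: finite_induct)
    case (insert i S)
    moreover have "\<psi> i a = 1 \<or> \<psi> i a = -1"
      using insert.prems unit assms(2) by simp
    ultimately show ?case by auto
  qed simp
  thus ?thesis using assms(2) by (simp add: char_prod_def)
qed

lemma char_prod_cases: "S \<subseteq> I \<Longrightarrow> char_prod S a \<in> {-1, 0, 1}"
  using char_prod_unit[of S a] by (cases "coprime a N") (auto simp: char_prod_def)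

lemma char_prod_generator:
  assumes "S \<subseteq> I" "coprime u N" "i \<in> I" "\<psi> i u = -1" "\<forall>j\<in>I - {i}. \<psi> j u = 1"
  shows "char_prod S u = (if i \<in> S then -1 else 1)"
proof -
  have fin: "finite S" using assms finite by (auto intro: finite_subset)
  have one: "(\<Prod>j\<in>S - {i}. \<psi> j u) = 1"
    using assms by (intro prod.neutral) auto
  show ?thesis
  proof (cases "i \<in> S")
    case True
    thus ?thesis using assms one fin by (simp add: char_prod_def prod.remove[of S i])
  next
    case False
    thus ?thesis using assms one by (simp add: char_prod_def)
  qed
qed

lemma real_character_char_prod: "S \<subseteq> I \<Longrightarrow> real_character (char_prod S)"
proof
  assume S: "S \<subseteq> I"
  show "char_prod S (a * b) = char_prod S a * char_prod S b" for a b
    by (rule char_prod_mult[OF S])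
  show "char_prod S a \<in> {-1, 0, 1}" for a
    by (rule char_prod_cases[OF S])
  have "char_prod S 1 \<noteq> 0" using char_prod_unit[OF S, of 1] by auto
  moreover have "char_prod S 1 * char_prod S 1 = char_prod S 1"
    using char_prod_mult[OF S, of 1 1] by simp
  ultimately show "char_prod S 1 = 1" by simp
qed

text \<open>With \<open>r\<close> the divisor sum of \<open>\<chi>\<close>, the two Lambert series \<open>\<Sum> r n t ^ n\<close> and
  \<open>\<Sum> \<chi> n * r n t ^ n\<close> diverge as \<open>t \<rightarrow> 1\<close>, because \<open>r\<close> is at least 1 on squares; twisting by any
  other product of the characters gives a convolution of two nontrivial characters and hence a
  bounded series. So the weights \<open>\<Prod>i\<in>I. 1 + \<epsilon> i * \<psi> i n\<close> cannot vanish on the support of \<open>r\<close>.\<close>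

theorem prescribed_values:
  fixes \<epsilon> :: "'i \<Rightarrow> real"
  assumes S0: "S0 \<subseteq> I" "S0 \<noteq> {}" and \<epsilon>: "\<And>i. i \<in> I \<Longrightarrow> \<epsilon> i = 1 \<or> \<epsilon> i = -1"
    and compatible: "(\<Prod>i\<in>S0. \<epsilon> i) = 1"
  obtains n where "n > 0" "coprime n N" "\<And>i. i \<in> I \<Longrightarrow> \<psi> i n = \<epsilon> i"
    "\<And>q. prime q \<Longrightarrow> odd (multiplicity q n) \<Longrightarrow> (\<Prod>i\<in>S0. \<psi> i q) = 1"
proof -
  define \<chi> where "\<chi> = char_prod S0"
  interpret \<chi>: real_character \<chi>
    unfolding \<chi>_def by (rule real_character_char_prod) fact
  define r where "r = \<chi>.divisor_sum"
  define L where "L = (\<lambda>S t. \<Sum>\<^sub>\<infinity>n\<in>{1..}. char_prod S n * r n * t ^ n)"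
  \<comment> \<open>On units P S is the product over the symmetric difference of S and S0, so it is
    nontrivial unless S = S0.\<close>
  define P where "P = (\<lambda>S n. char_prod S n * \<chi> n)"
  have abs_le: "\<bar>char_prod S n\<bar> \<le> 1" "\<bar>P S n\<bar> \<le> 1" if "S \<subseteq> I" for S n
    using char_prod_cases[OF that, of n] char_prod_cases[OF S0(1), of n] by (auto simp: P_def \<chi>_def)
  have conv: "char_prod S n * r n = dconv (P S) (char_prod S) n" if "S \<subseteq> I" for S n
  proof -
    have "char_prod S n * r n = (\<Sum>d | d dvd n. char_prod S n * \<chi> d)"
      by (simp add: r_def \<chi>.divisor_sum_def sum_distrib_left)
    also have "\<dots> = (\<Sum>d | d dvd n. P S d * char_prod S (n div d))"
    proof (rule sum.cong)
      fix d assume "d \<in> {d. d dvd n}"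
      hence "n = d * (n div d)" by simp
      hence "char_prod S n = char_prod S d * char_prod S (n div d)"
        using char_prod_mult[OF that] by metis
      thus "char_prod S n * \<chi> d = P S d * char_prod S (n div d)" by (simp add: P_def)
    qed simp
    finally show ?thesis by (simp add: dconv_def)
  qed
  have summable: "(\<lambda>n. char_prod S n * r n * t ^ n) summable_on {1..}" if "S \<subseteq> I" "0 < t" "t < 1" for S t
    using that conv abs_le dconv_summable[of "P S" "char_prod S" t] by simp
  have bounded: "\<exists>C. \<forall>t. 0 < t \<longrightarrow> t < 1 \<longrightarrow> \<bar>L S t\<bar> \<le> C" if S: "S \<subseteq> I" "S \<noteq> {}" "S \<noteq> S0" for S
  proof -
    obtain i where i: "i \<in> S" using S by blast
    \<comment> \<open>An index in exactly one of the two sets is where P S takes the value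
      -1.\<close>
    obtain j where j: "j \<in> S \<union> S0" "j \<notin> S \<inter> S0" using S by blast
    have ij: "i \<in> I" "j \<in> I" using i j S S0 by auto
    obtain u where u: "coprime u N" "\<psi> i u = -1" "\<forall>k\<in>I - {i}. \<psi> k u = 1"
      using independent[OF ij(1)] by blast
    obtain v where v: "coprime v N" "\<psi> j v = -1" "\<forall>k\<in>I - {j}. \<psi> k v = 1"
      using independent[OF ij(2)] by blast
    have "char_prod S u = -1" using char_prod_generator[OF S(1) u(1) ij(1) u(2,3)] i by simp
    hence s1: "(\<Sum>k=1..N. char_prod S k) = 0"
      using char_prod_mult[OF S(1)] char_prod_periodic[OF S(1)] u(1) N_pos
      by (intro nontrivial_character_sum_zero[of _ _ u]) auto
    have "P S v = -1"
      using char_prod_generator[OF S(1) v(1) ij(2) v(2,3)] char_prod_generator[OF S0(1) v(1) ij(2) v(2,3)] j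
      by (auto simp: P_def \<chi>_def)
    hence s2: "(\<Sum>k=1..N. P S k) = 0"
      using char_prod_mult[OF S(1)] char_prod_periodic[OF S(1)] char_prod_mult[OF S0(1)] char_prod_periodic[OF S0(1)] v(1) N_pos
      by (intro nontrivial_character_sum_zero[of _ _ v]) (auto simp: P_def \<chi>_def)
    obtain C where "\<And>t. 0 < t \<Longrightarrow> t < 1 \<Longrightarrow> \<bar>\<Sum>\<^sub>\<infinity>n\<in>{1..}. dconv (P S) (char_prod S) n * t ^ n\<bar> \<le> C"
      using dconv_Abel_bounded[of "P S" N "char_prod S"] s1 s2 abs_le[OF S(1)] N_pos
        char_prod_periodic[OF S(1)] char_prod_periodic[OF S0(1)] by (auto simp: P_def \<chi>_def)
    thus ?thesis unfolding L_def conv[OF S(1)] by blast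
  qed
  then obtain C where C: "\<And>S t. S \<subseteq> I \<Longrightarrow> S \<noteq> {} \<Longrightarrow> S \<noteq> S0 \<Longrightarrow> 0 < t \<Longrightarrow> t < 1 \<Longrightarrow> \<bar>L S t\<bar> \<le> C S"
    by metis
  define M where "M = (\<Sum>S\<in>Pow I - {{}, S0}. C S)"
  have "\<exists>n>0. coprime n N \<and> r n > 0 \<and> (\<forall>i\<in>I. \<psi> i n = \<epsilon> i)"
  proof (rule ccontr)
    assume none: "\<not> ?thesis"
    have vanish: "(\<Sum>S\<in>Pow I. (\<Prod>i\<in>S. \<epsilon> i) * (char_prod S n * r n)) = 0" if "n > 0" for n
    proof (cases "coprime n N")
      case True
      \<comment> \<open>Each factor of the product is 2 or 0, so the product detects the prescribed
        values; expanding it over subsets of I yields the twisted series.\<close>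
      have "(\<Prod>i\<in>I. \<epsilon> i * \<psi> i n + 1) * r n = 0"
      proof (cases "\<forall>i\<in>I. \<psi> i n = \<epsilon> i")
        case True
        hence "\<not> r n > 0" using none \<open>coprime n N\<close> that by blast
        thus ?thesis using \<chi>.divisor_sum_nonneg[OF that] by (simp add: r_def)
      next
        case False
        then obtain i where i: "i \<in> I" "\<psi> i n \<noteq> \<epsilon> i" by blast
        hence "\<epsilon> i * \<psi> i n + 1 = 0" using unit[OF i(1) True] \<epsilon>[OF i(1)] by auto
        hence "(\<Prod>i\<in>I. \<epsilon> i * \<psi> i n + 1) = 0" using i finite by (meson prod_zero)
        thus ?thesis by simp
      qed
      moreover have "(\<Prod>i\<in>I. \<epsilon> i * \<psi> i n + 1) = (\<Sum>S\<in>Pow I. (\<Prod>i\<in>S. \<epsilon> i) * char_prod S n)"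
        using True by (simp add: prod_add[OF finite] char_prod_def prod.distrib)
      ultimately show ?thesis by (simp add: sum_distrib_right mult.assoc)
    qed (simp add: char_prod_def)
    have total: "(\<Sum>S\<in>Pow I. (\<Prod>i\<in>S. \<epsilon> i) * L S t) = 0" if t: "0 < t" "t < 1" for t
    proof -
      have "(\<Sum>S\<in>Pow I. (\<Prod>i\<in>S. \<epsilon> i) * L S t)
          = (\<Sum>S\<in>Pow I. \<Sum>\<^sub>\<infinity>n\<in>{1..}. (\<Prod>i\<in>S. \<epsilon> i) * (char_prod S n * r n * t ^ n))"
        unfolding L_def by (simp add: infsum_cmult_right')
      also have "\<dots> = (\<Sum>\<^sub>\<infinity>n\<in>{1..}. \<Sum>S\<in>Pow I. (\<Prod>i\<in>S. \<epsilon> i) * (char_prod S n * r n * t ^ n))"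
        using summable t by (intro infsum_finite_sum[THEN conjunct1, symmetric] summable_on_cmult_right) (auto simp: finite)
      also have "\<dots> = (\<Sum>\<^sub>\<infinity>n\<in>{1..}. (\<Sum>S\<in>Pow I. (\<Prod>i\<in>S. \<epsilon> i) * (char_prod S n * r n)) * t ^ n)"
        by (simp add: sum_distrib_right mult.assoc)
      also have "\<dots> = 0"
        by (intro infsum_0) (use vanish in auto)
      finally show ?thesis .
    qed
    have upper: "L {} t + L S0 t \<le> M" if t: "0 < t" "t < 1" for t
    proof -
      have "{{}, S0} \<subseteq> Pow I" using S0 by auto
      hence "(\<Sum>S\<in>Pow I. (\<Prod>i\<in>S. \<epsilon> i) * L S t)
          = (\<Sum>S\<in>{{}, S0}. (\<Prod>i\<in>S. \<epsilon> i) * L S t) + (\<Sum>S\<in>Pow I - {{}, S0}. (\<Prod>i\<in>S. \<epsilon> i) * L S t)"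
        using finite by (subst sum.subset_diff[of "{{}, S0}"]) auto
      \<comment> \<open>Here compatibility enters: the coefficient of the second unbounded series is
        +1, so it reinforces the first one instead of cancelling it.\<close>
      also have "(\<Sum>S\<in>{{}, S0}. (\<Prod>i\<in>S. \<epsilon> i) * L S t) = L {} t + L S0 t"
        using S0 compatible by simp
      finally have "L {} t + L S0 t = (\<Sum>S\<in>Pow I - {{}, S0}. - ((\<Prod>i\<in>S. \<epsilon> i) * L S t))"
        using total[OF t] by (simp add: sum_negf)
      also have "\<dots> \<le> M"
        unfolding M_def
      proof (rule sum_mono)
        fix S assume S: "S \<in> Pow I - {{}, S0}"
        hence "\<bar>\<Prod>i\<in>S. \<epsilon> i\<bar> = 1"
          unfolding abs_prod using \<epsilon> by (intro prod.neutral) fastforce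
        hence "\<bar>(\<Prod>i\<in>S. \<epsilon> i) * L S t\<bar> \<le> C S"
          using C[of S t] S t by (simp add: abs_mult)
        thus "- ((\<Prod>i\<in>S. \<epsilon> i) * L S t) \<le> C S" by linarith
      qed
      finally show ?thesis .
    qed
    \<comment> \<open>The bound M does not depend on t, so J can be fixed before t is moved towards
      1.\<close>
    obtain J :: nat where J: "J > M" using reals_Archimedean2 by blast
    obtain t where t: "0 < t" "t < 1" and Jt: "(\<Sum>k<J. t ^ ((k * N + 1)^2)) \<ge> J / 2"
      using sum_powers_squares_unbounded[where J = J and N = N] by blast
    define h where "h = (\<lambda>n. (char_prod {} n + \<chi> n) * r n * t ^ n)"
    have h_nonneg: "h n \<ge> 0" if "n > 0" for n
    proof -
      have "char_prod {} n + \<chi> n \<ge> 0"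
        using char_prod_cases[OF S0(1), of n] by (auto simp: \<chi>_def char_prod_def)
      thus ?thesis using \<chi>.divisor_sum_nonneg[OF that] t by (simp add: h_def r_def)
    qed
    have h_summable: "h summable_on {1..}"
      using summable_on_add[OF summable[of "{}" t] summable[OF S0(1), of t]] t
      by (simp add: h_def \<chi>_def algebra_simps)
    \<comment> \<open>The factor 2 arises because the principal character and \<open>\<chi>\<close>
      are both 1 at squares of units.\<close>
    have "real J \<le> (\<Sum>k<J. 2 * t ^ ((k * N + 1)^2))"
      using Jt by (simp add: sum_distrib_left[symmetric])
    also have "\<dots> \<le> (\<Sum>k<J. h ((k * N + 1)^2))"
    proof (rule sum_mono)
      fix k
      define a where "a = k * N + 1"
      have cop: "coprime a N"
        unfolding a_def by (metis coprime_1_left coprime_iff_gcd_eq_1 gcd_add_mult add.commute gcd.commute)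
      have "\<chi> a * \<chi> a = 1"
        using char_prod_unit[OF S0(1) cop] by (auto simp: \<chi>_def)
      hence "\<chi> (a^2) = 1" by (simp add: \<chi>.mult power2_eq_square)
      moreover have "char_prod {} (a^2) = 1" using cop by (simp add: char_prod_def)
      moreover have "r (a^2) \<ge> 1" unfolding r_def by (rule \<chi>.divisor_sum_square) (simp add: a_def)
      ultimately show "2 * t ^ (a^2) \<le> h (a^2)"
        using t by (simp add: h_def)
    qed
    also have "\<dots> = (\<Sum>n\<in>(\<lambda>k. (k * N + 1)^2) ` {..<J}. h n)"
      using N_pos by (subst sum.reindex) (auto intro!: inj_onI)
    also have "\<dots> \<le> infsum h {1..}"
      using h_nonneg by (intro finite_sum_le_infsum h_summable) auto
    also have "\<dots> = L {} t + L S0 t"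
      unfolding L_def using summable[of "{}" t] summable[OF S0(1), of t] t
      by (subst infsum_add[symmetric]) (auto simp: h_def \<chi>_def algebra_simps)
    also have "\<dots> \<le> M" by (rule upper) fact+
    finally show False using J by simp
  qed
  then obtain n where n: "n > 0" "coprime n N" "r n > 0" "\<forall>i\<in>I. \<psi> i n = \<epsilon> i" by blast
  show thesis
  proof (rule that[OF n(1,2)])
    fix q assume q: "prime q" "odd (multiplicity q n)"
    have "q dvd n"
    proof (rule ccontr)
      assume "\<not> q dvd n"
      hence "multiplicity q n = 0" by (rule not_dvd_imp_multiplicity_0)
      thus False using q(2) by simp
    qed
    hence cop: "coprime q N" using n(2) coprime_divisors[of q n N N] by simp
    have "\<chi> q \<noteq> -1" using \<chi>.divisor_sum_pos_imp[of n q] n(1,3) q by (simp add: r_def)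
    hence "\<chi> q = 1" using char_prod_unit[OF S0(1) cop] by (simp add: \<chi>_def)
    thus "(\<Prod>i\<in>S0. \<psi> i q) = 1" using cop by (simp add: \<chi>_def char_prod_def)
  qed (use n in simp)
qed

end

section \<open>Legendre symbols\<close>

lemma Legendre_cases: "Legendre a p = -1 \<or> Legendre a p = 0 \<or> Legendre a p = 1"
  by (simp add: Legendre_def)

lemma Legendre_eq_0_iff: "Legendre a p = 0 \<longleftrightarrow> p dvd a"
  by (simp add: Legendre_def cong_0_iff)

lemma Legendre_unit: "\<not> p dvd a \<Longrightarrow> Legendre a p = 1 \<or> Legendre a p = -1"
  using Legendre_cases Legendre_eq_0_iff by metis

lemma Legendre_eqI:
  assumes "x = -1 \<or> x = 0 \<or> x = 1" "[Legendre a p = x] (mod p)" "p > 2"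
  shows "Legendre a p = x"
proof -
  have "p dvd Legendre a p - x" using assms(2) by (simp add: cong_iff_dvd_diff)
  moreover have "\<bar>Legendre a p - x\<bar> \<le> 2" using assms(1) Legendre_cases[of a p] by auto
  ultimately show ?thesis
    using assms(3) dvd_imp_le_int[of "Legendre a p - x" p] by fastforce
qed

lemma Legendre_cong: "[a = b] (mod p) \<Longrightarrow> Legendre a p = Legendre b p"
  unfolding Legendre_def QuadRes_def by (simp add: cong_def)

lemma Legendre_mult:
  fixes p :: nat
  assumes "prime p" "p > 2"
  shows "Legendre (a * b) p = Legendre a p * Legendre b p"
proof (rule Legendre_eqI)
  have "[Legendre a p * Legendre b p = a ^ ((p - 1) div 2) * b ^ ((p - 1) div 2)] (mod p)"
    using assms by (intro cong_mult euler_criterion)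
  moreover have "[Legendre (a * b) p = (a * b) ^ ((p - 1) div 2)] (mod p)"
    using assms by (intro euler_criterion)
  ultimately show "[Legendre (a * b) p = Legendre a p * Legendre b p] (mod p)"
    by (metis cong_sym cong_trans power_mult_distrib)
  show "Legendre a p * Legendre b p = -1 \<or> Legendre a p * Legendre b p = 0 \<or> Legendre a p * Legendre b p = 1"
    using Legendre_cases[of a p] Legendre_cases[of b p] by fastforce
qed (use assms in simp)

lemma Legendre_square:
  fixes p :: nat
  assumes "prime p" "p > 2" "\<not> int p dvd a"
  shows "Legendre a p * Legendre a p = 1"
  using Legendre_unit[OF assms(3)] by auto

lemma Legendre_one: "prime (p::nat) \<Longrightarrow> Legendre 1 p = 1"
proof -
  assume p: "prime p"
  have "QuadRes p 1" unfolding QuadRes_def by (rule exI[of _ 1]) simp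
  moreover have "\<not> [1 = 0] (mod int p)" using p by (auto simp: cong_0_iff)
  ultimately show ?thesis by (simp add: Legendre_def)
qed

section \<open>The characters modulo 4 and 8 and the laws of reciprocity\<close>

definition \<chi>4 :: "nat \<Rightarrow> int" where
  "\<chi>4 n = (if n mod 4 = 1 then 1 else if n mod 4 = 3 then -1 else 0)"

definition \<chi>8 :: "nat \<Rightarrow> int" where
  "\<chi>8 n = (if n mod 8 \<in> {1, 7} then 1 else if n mod 8 \<in> {3, 5} then -1 else 0)"

lemma \<chi>4_mult: "\<chi>4 (a * b) = \<chi>4 a * \<chi>4 b"
proof -
  have "a mod 4 \<in> {0, 1, 2, 3}" "b mod 4 \<in> {0, 1, 2, 3}" by auto
  moreover have "(a * b) mod 4 = (a mod 4) * (b mod 4) mod 4" by (simp add: mod_mult_eq)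
  ultimately show ?thesis unfolding \<chi>4_def by (elim insertE emptyE) simp_all
qed

lemma \<chi>8_mult: "\<chi>8 (a * b) = \<chi>8 a * \<chi>8 b"
proof -
  have "n mod 8 \<in> {0, 1, 2, 3, 4, 5, 6, 7}" for n :: nat by auto
  from this[of a] this[of b] have "a mod 8 \<in> {0, 1, 2, 3, 4, 5, 6, 7}" "b mod 8 \<in> {0, 1, 2, 3, 4, 5, 6, 7}" .
  moreover have "(a * b) mod 8 = (a mod 8) * (b mod 8) mod 8" by (simp add: mod_mult_eq)
  ultimately show ?thesis unfolding \<chi>8_def by (elim insertE emptyE) simp_all
qed

lemma \<chi>4_unit: "odd n \<Longrightarrow> \<chi>4 n = 1 \<or> \<chi>4 n = -1"
proof -
  assume "odd n"
  hence "n mod 4 = 1 \<or> n mod 4 = 3" by presburger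
  thus ?thesis unfolding \<chi>4_def by auto
qed

lemma \<chi>8_unit: "odd n \<Longrightarrow> \<chi>8 n = 1 \<or> \<chi>8 n = -1"
proof -
  assume "odd n"
  hence "n mod 8 = 1 \<or> n mod 8 = 3 \<or> n mod 8 = 5 \<or> n mod 8 = 7" by presburger
  thus ?thesis unfolding \<chi>8_def by auto
qed

lemma minus_one_power_eq_\<chi>4:
  assumes "odd p"
  shows "(-1) ^ ((p - 1) div 2) = \<chi>4 p"
proof -
  obtain k where "p = 2 * k + 1" using assms by (elim oddE)
  thus ?thesis by (cases "even k") (auto simp: \<chi>4_def elim!: evenE oddE)
qed

lemma Legendre_minus_one:
  assumes "prime p" "p > 2"
  shows "Legendre (-1) p = \<chi>4 p"
proof (rule Legendre_eqI)
  have "odd p" using assms by (simp add: prime_odd_nat)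
  thus "[Legendre (-1) p = \<chi>4 p] (mod p)"
    using euler_criterion[OF assms, of "-1"] minus_one_power_eq_\<chi>4 by metis
qed (use assms in \<open>simp_all add: \<chi>4_def\<close>)

text \<open>Gauss's lemma with multiplier 2: with H = (p - 1)/2, the doubles exceeding H are those
  of the x in (H/2, H], and the parity of their number depends on p modulo 8.\<close>

lemma Legendre_two:
  assumes "prime p" "p > 2"
  shows "Legendre 2 p = \<chi>8 p"
proof -
  have odd: "odd p" using assms by (simp add: prime_odd_nat)
  interpret GAUSS p 2
    using assms by unfold_locales (auto simp: cong_0_iff dest: zdvd_imp_le)
  define H where "H = (int p - 1) div 2"
  have p: "int p = 2 * H + 1" using p_eq2 unfolding H_def .
  \<comment> \<open>The doubles are at most p - 1, so reduction modulo p leaves them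
    unchanged.\<close>
  have "C = (\<lambda>x. x * 2) ` A"
    unfolding C_def B_def image_image by (rule image_cong) (auto simp: A_def H_def[symmetric] p)
  hence "E = (\<lambda>x. x * 2) ` {H div 2 <.. H}"
    unfolding E_def A_def H_def[symmetric] by auto
  hence "card E = nat (H - H div 2)"
    by (simp add: card_image inj_on_def)
  moreover have "even (nat (H - H div 2)) \<longleftrightarrow> p mod 8 \<in> {1, 7}"
  proof -
    have "H \<ge> 0" using p assms by linarith
    hence "even (nat (H - H div 2)) \<longleftrightarrow> even (H - H div 2)"
      by (simp add: even_nat_iff)
    also have "\<dots> \<longleftrightarrow> int p mod 8 = 1 \<or> int p mod 8 = 7"
      unfolding p by presburger
    also have "int p mod 8 = int (p mod 8)" by (simp add: zmod_int)
    also have "(int (p mod 8) = 1 \<or> int (p mod 8) = 7) \<longleftrightarrow> p mod 8 \<in> {1, 7}"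
      unfolding insert_iff empty_iff by presburger
    finally show ?thesis .
  qed
  ultimately show ?thesis
    using gauss_lemma \<chi>8_unit[OF odd] by (auto simp: \<chi>8_def split: if_splits)
qed

text \<open>The signed prime \<open>\<chi>4 p * p\<close> absorbs the sign of the law, which makes
  it multiplicative in p.\<close>

lemma Legendre_reciprocity:
  fixes p q :: nat
  assumes "prime p" "p > 2" "prime q" "q > 2" "p \<noteq> q"
  shows "Legendre q p = Legendre (\<chi>4 p * p) q"
proof -
  have odd: "odd p" "odd q" using assms by (simp_all add: prime_odd_nat)
  have unit: "Legendre q p = 1 \<or> Legendre q p = -1" "Legendre p q = 1 \<or> Legendre p q = -1"
    using assms by (auto intro!: Legendre_unit simp: primes_dvd_imp_eq dest: primes_dvd_imp_eq)
  have "Legendre p q * Legendre q p = \<chi>4 p ^ ((q - 1) div 2)"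
    using Quadratic_Reciprocity[OF assms] minus_one_power_eq_\<chi>4[OF odd(1)] by (simp add: power_mult)
  moreover have "\<chi>4 p ^ ((q - 1) div 2) = Legendre (\<chi>4 p) q"
  proof (cases "\<chi>4 p = 1")
    case True
    thus ?thesis using Legendre_one assms by simp
  next
    case False
    hence "\<chi>4 p = -1" using \<chi>4_unit[OF odd(1)] by simp
    thus ?thesis using Legendre_minus_one[OF assms(3,4)] minus_one_power_eq_\<chi>4[OF odd(2)] by simp
  qed
  moreover have "Legendre q p = (Legendre p q * Legendre q p) * Legendre p q"
    using unit(2) by auto
  ultimately have "Legendre q p = Legendre (\<chi>4 p) q * Legendre p q"
    by metis
  thus ?thesis using Legendre_mult[OF assms(3,4)] by simp
qed

lemma \<chi>4_prod: "finite P \<Longrightarrow> \<chi>4 (\<Prod>P) = (\<Prod>p\<in>P. \<chi>4 p)"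
  by (induction P rule: finite_induct) (auto simp: \<chi>4_mult, simp add: \<chi>4_def)

lemma \<chi>8_prod: "finite P \<Longrightarrow> \<chi>8 (\<Prod>P) = (\<Prod>p\<in>P. \<chi>8 p)"
  by (induction P rule: finite_induct) (auto simp: \<chi>8_mult, simp add: \<chi>8_def)

lemma Legendre_prod:
  fixes q :: nat
  assumes "finite P" "prime q" "q > 2"
  shows "Legendre (\<Prod>p\<in>P. f p) q = (\<Prod>p\<in>P. Legendre (f p) q)"
  using assms(1) by (induction P rule: finite_induct) (use assms Legendre_one Legendre_mult in auto)

text \<open>Turns characters of varying moduli p, evaluated at q, into one symbol with modulus q;
  this is how conditions on the prime factors of c become conditions of the form (-3m / q) =
  1.\<close>

lemma prod_Legendre_reciprocity:
  fixes q :: nat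
  assumes "finite P" "\<And>p. p \<in> P \<Longrightarrow> prime p \<and> p > 2" "prime q" "q > 2" "q \<notin> P"
  shows "(\<Prod>p\<in>P. Legendre q p) = Legendre (\<chi>4 (\<Prod>P) * int (\<Prod>P)) q"
proof -
  have "(\<Prod>p\<in>P. Legendre q p) = (\<Prod>p\<in>P. Legendre (\<chi>4 p * p) q)"
    using assms by (intro prod.cong Legendre_reciprocity) auto
  also have "\<dots> = Legendre (\<Prod>p\<in>P. \<chi>4 p * p) q"
    using assms by (intro Legendre_prod[symmetric])
  also have "(\<Prod>p\<in>P. \<chi>4 p * p) = \<chi>4 (\<Prod>P) * int (\<Prod>P)"
    using assms by (simp add: \<chi>4_prod prod.distrib)
  finally show ?thesis .
qed

text \<open>A primitive root is one, by Euler's criterion and its order p - 1.\<close>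

lemma exists_nonresidue:
  fixes p :: nat
  assumes "prime p" "p > 2"
  obtains a :: nat where "Legendre a p = -1"
proof -
  obtain g where g: "residue_primroot p g"
    using prime_primitive_root_exists[of p] assms by auto
  hence "coprime p g" and ord: "ord p g = p - 1"
    using assms by (auto simp: residue_primroot_def totient_prime)
  have "\<not> [g ^ ((p - 1) div 2) = 1] (mod p)"
  proof
    assume "[g ^ ((p - 1) div 2) = 1] (mod p)"
    hence "p - 1 dvd (p - 1) div 2" using ord by (metis ord_divides)
    moreover have "0 < (p - 1) div 2" "(p - 1) div 2 < p - 1" using assms by auto
    ultimately show False by (metis nat_dvd_not_less)
  qed
  hence "\<not> [int g ^ ((p - 1) div 2) = 1] (mod p)"
    by (metis cong_int_iff of_nat_1 of_nat_power)
  hence "Legendre g p \<noteq> 1"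
    using euler_criterion[OF assms, of g] by (auto simp: cong_sym_eq)
  moreover have "\<not> int p dvd int g"
    using \<open>coprime p g\<close> assms by (metis coprime_absorb_left int_dvd_int_iff not_prime_unit)
  ultimately show ?thesis using that[of g] Legendre_unit by blast
qed

text \<open>If y^2 = -ab modulo p, then y/a is a root; u is the inverse of a.\<close>

lemma Legendre_one_imp_root:
  fixes p :: nat
  assumes "Legendre (- (a * b)) p = 1" "prime p"
  obtains x where "int p dvd a * x^2 + b"
proof -
  have nd: "\<not> int p dvd a * b" and "QuadRes p (- (a * b))"
    using assms by (auto simp: Legendre_def cong_0_iff split: if_splits)
  then obtain y where y: "[y^2 = - (a * b)] (mod p)" unfolding QuadRes_def by blast
  have "coprime a p"
    using nd assms by (metis coprime_commute dvd_mult2 prime_imp_coprime prime_nat_int_transfer)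
  then obtain u where u: "[a * u = 1] (mod p)" using cong_solve_coprime_int by blast
  have "[a * (a * (u * y)^2 + b) = (a * u)^2 * y^2 + a * b] (mod p)"
    by (simp add: power2_eq_square algebra_simps)
  also have "[(a * u)^2 * y^2 + a * b = 1^2 * - (a * b) + a * b] (mod p)"
    by (intro cong_add cong_mult cong_pow u y cong_refl)
  finally have "int p dvd a * (a * (u * y)^2 + b)" by (simp add: cong_0_iff)
  hence "int p dvd a * (u * y)^2 + b"
    using \<open>coprime a p\<close> by (simp add: coprime_commute coprime_dvd_mult_right_iff)
  thus ?thesis using that by blast
qed

lemma squarefree_root:
  fixes n :: nat
  assumes "squarefree n" "\<And>p. prime p \<Longrightarrow> p dvd n \<Longrightarrow> \<exists>x. int p dvd a * x^2 + b"
  shows "\<exists>x. int n dvd a * x^2 + b"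
  using assms
proof (induction n rule: less_induct)
  case (less n)
  show ?case
  proof (cases "n = 1")
    case False
    then obtain p where p: "prime p" "p dvd n" using prime_factor_nat by blast
    then obtain m where n: "n = p * m" by blast
    have n0: "n \<noteq> 0" using less.prems(1) by (metis not_squarefree_0)
    have "\<not> p^2 dvd n"
      using less.prems(1) p n0 by (simp add: squarefree_factorial_semiring)
    hence "\<not> p dvd m" by (auto simp: n power2_eq_square)
    hence cop: "coprime (int p) (int m)" using p by (simp add: prime_imp_coprime)
    have "m < n" using p n0 prime_gt_1_nat[of p] by (simp add: n)
    moreover have "squarefree m" using less.prems(1) n squarefree_multD(2) by blast
    ultimately obtain y where y: "int m dvd a * y^2 + b"
      using less n by (metis dvd_mult)
    obtain z where z: "int p dvd a * z^2 + b" using less.prems(2) p by blast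
    obtain x where x: "[x = z] (mod int p)" "[x = y] (mod int m)"
      using binary_chinese_remainder_int[OF cop] by blast
    have "[a * x^2 + b = a * z^2 + b] (mod int p)" "[a * x^2 + b = a * y^2 + b] (mod int m)"
      by (intro cong_add cong_mult cong_pow x cong_refl)+
    hence "int p dvd a * x^2 + b" "int m dvd a * x^2 + b"
      using y z by (simp_all add: cong_dvd_iff)
    hence "int p * int m dvd a * x^2 + b" using cop by (simp add: divides_mult)
    thus ?thesis using n by auto
  qed simp
qed

text \<open>The indices 1 and 2 are used for the characters modulo 4 and 8, every other index for the
  Legendre symbol of an odd prime.\<close>

definition quad_char :: "nat \<Rightarrow> nat \<Rightarrow> int" where
  "quad_char i n = (if i = 1 then \<chi>4 n else if i = 2 then \<chi>8 n else Legendre n i)"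

lemma quad_char_odd_prime: "p > 2 \<Longrightarrow> quad_char p n = Legendre n p"
  by (simp add: quad_char_def)

lemma dvd_Prod: "finite (A :: nat set) \<Longrightarrow> a \<in> A \<Longrightarrow> a dvd \<Prod>A"
  using dvd_prodI[of A a "\<lambda>x. x"] by simp

lemma odd_if_coprime_mult_8:
  fixes a m :: nat
  assumes "coprime a (8 * m)"
  shows "odd a"
  using coprime_common_divisor[OF assms, of 2] by (auto simp: dvd_mult2)

lemma real_characters_quad_char:
  assumes fin: "finite P" and P: "\<And>p. p \<in> P \<Longrightarrow> prime p \<and> p > 2"
  shows "real_characters ({1, 2} \<union> P) (\<lambda>i n. real_of_int (quad_char i n)) (8 * \<Prod>P)"
proof
  let ?N = "8 * \<Prod>P"
  have pos: "\<Prod>P > 0"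
  proof (rule prod_pos)
    show "0 < p" if "p \<in> P" for p using P[OF that] by simp
  qed
  have odd_N: "odd a" if "coprime a ?N" for a
    using that by (rule odd_if_coprime_mult_8)
  have ndvd: "\<not> p dvd a" if "coprime a ?N" "p \<in> P" for a p
  proof
    assume "p dvd a"
    moreover have "p dvd ?N" using that(2) fin by (intro dvd_mult dvd_Prod)
    ultimately have "p dvd 1" using that(1) by (metis coprime_common_divisor)
    thus False using P[OF that(2)] by simp
  qed
  show "finite ({1, 2} \<union> P)" using fin by simp
  show "?N > 0" using pos by simp
  show "real_of_int (quad_char i (a * b)) = real_of_int (quad_char i a) * real_of_int (quad_char i b)"
    if "i \<in> {1, 2} \<union> P" for i a b
  proof -
    have "quad_char i (a * b) = quad_char i a * quad_char i b"
      using that P[of i] by (auto simp: quad_char_def \<chi>4_mult \<chi>8_mult Legendre_mult)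
    thus ?thesis by simp
  qed
  show "real_of_int (quad_char i (a + ?N)) = real_of_int (quad_char i a)"
    if "i \<in> {1, 2} \<union> P" for i a
  proof -
    have "(a + ?N) mod 4 = a mod 4" "(a + ?N) mod 8 = a mod 8" by presburger+
    moreover have "Legendre (int (a + ?N)) i = Legendre (int a) i" if "i \<in> P"
    proof (rule Legendre_cong)
      have "int i dvd int ?N" using that fin unfolding int_dvd_int_iff by (intro dvd_mult dvd_Prod)
      thus "[int (a + ?N) = int a] (mod int i)"
        by (simp add: cong_iff_dvd_diff)
    qed
    ultimately have "quad_char i (a + ?N) = quad_char i a"
      using that unfolding quad_char_def \<chi>4_def \<chi>8_def by auto
    thus ?thesis by simp
  qed
  show "real_of_int (quad_char i a) = 1 \<or> real_of_int (quad_char i a) = -1"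
    if "i \<in> {1, 2} \<union> P" "coprime a ?N" for i a
  proof -
    have "quad_char i a = 1 \<or> quad_char i a = -1"
      using that(1) \<chi>4_unit[OF odd_N[OF that(2)]] \<chi>8_unit[OF odd_N[OF that(2)]]
        Legendre_unit[of i a] ndvd[OF that(2), of i] by (auto simp: quad_char_def)
    thus ?thesis by auto
  qed
  show "\<exists>u. coprime u ?N \<and> real_of_int (quad_char i u) = -1
      \<and> (\<forall>j\<in>{1, 2} \<union> P - {i}. real_of_int (quad_char j u) = 1)"
    if i: "i \<in> {1, 2} \<union> P" for i
  proof -
    have one: "Legendre (int u) p = 1" if "[u = 1] (mod m)" "p dvd m" "p \<in> P" for u m p
    proof -
      have "[int u = 1] (mod p)" using cong_dvd_modulus_nat[OF that(1,2)] by (metis cong_int_iff of_nat_1)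
      thus ?thesis using Legendre_cong Legendre_one P[OF that(3)] by metis
    qed
    have coprime_N: "coprime u ?N" if "odd u" "\<And>p. p \<in> P \<Longrightarrow> Legendre (int u) p \<noteq> 0" for u
    proof -
      have "coprime u p" if "p \<in> P" for p
        using P[OF that] \<open>\<And>p. p \<in> P \<Longrightarrow> Legendre (int u) p \<noteq> 0\<close>[OF that] prime_imp_coprime[of p u]
        by (simp add: Legendre_eq_0_iff coprime_commute)
      hence "coprime u (\<Prod>P)" by (intro prod_coprime_right) auto
      moreover have "coprime u (2 ^ 3)" using that(1) by (subst coprime_power_right_iff) simp
      ultimately show ?thesis by simp
    qed
    have "odd (\<Prod>P)"
      using fin P by (induction P rule: finite_induct) (auto simp: prime_odd_nat)
    hence cop8: "coprime (8 :: nat) (\<Prod>P)"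
      using coprime_power_left_iff[of 2 3 "\<Prod>P"] by simp
    have "\<exists>u. odd u \<and> quad_char i u = -1 \<and> (\<forall>j\<in>{1, 2} \<union> P - {i}. quad_char j u = 1)"
    proof (cases "i \<in> P")
      case True
      have ip: "prime i" "i > 2" using P True by auto
      obtain a :: nat where a: "Legendre a i = -1" using exists_nonresidue[OF ip] by blast
      define m where "m = 8 * \<Prod>(P - {i})"
      have "coprime i p" if "p \<in> P - {i}" for p
        using P[of p] that ip by (intro primes_coprime) auto
      hence "coprime i (\<Prod>(P - {i}))" by (intro prod_coprime_right) auto
      moreover have "coprime i (2 ^ 3)" using ip by (subst coprime_power_right_iff) (simp add: prime_odd_nat)
      ultimately have "coprime i m" by (simp add: m_def)
      then obtain u where u: "[u = a] (mod i)" "[u = 1] (mod m)"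
        using binary_chinese_remainder_nat by blast
      have "[u = 1] (mod 8)" using cong_dvd_modulus_nat[OF u(2)] by (simp add: m_def)
      hence u8: "u mod 8 = 1" by (simp add: cong_def)
      hence "u mod 4 = 1" "odd u" by presburger+
      moreover have "Legendre u i = -1"
        using Legendre_cong[of u a i] u(1) a by (simp add: cong_int_iff)
      moreover have "Legendre u p = 1" if "p \<in> P - {i}" for p
        using one[OF u(2), of p] that fin by (simp add: m_def dvd_Prod)
      ultimately show ?thesis
        using ip u8 P by (intro exI[of _ u]) (auto simp: quad_char_def \<chi>4_def \<chi>8_def)
    next
      case False
      \<comment> \<open>Modulo 8, the class 7 has \<open>\<chi>4\<close> = -1 and
        \<open>\<chi>8\<close> = 1, and the class 5 has the opposite signs.\<close>
      obtain u where u: "[u = (if i = 1 then 7 else 5)] (mod 8)" "[u = 1] (mod \<Prod>P)"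
        using binary_chinese_remainder_nat[OF cop8] by blast
      have u8: "u mod 8 = (if i = 1 then 7 else 5)" using u(1) by (auto simp: cong_def)
      hence "u mod 4 = (if i = 1 then 3 else 1)" "odd u" by (auto split: if_splits) presburger+
      moreover have "Legendre u p = 1" if "p \<in> P" for p
        using one[OF u(2), of p] that fin by (simp add: dvd_Prod)
      ultimately show ?thesis
        using u8 P i False by (intro exI[of _ u]) (auto simp: quad_char_def \<chi>4_def \<chi>8_def)
    qed
    then obtain u where u: "odd u" "quad_char i u = -1" "\<And>j. j \<in> {1, 2} \<union> P - {i} \<Longrightarrow> quad_char j u = 1" by blast
    have "Legendre (int u) p \<noteq> 0" if "p \<in> P" for p
      using u(2) u(3)[of p] that P[of p] by (cases "p = i") (auto simp: quad_char_def)
    hence "coprime u ?N" using coprime_N u(1) by blast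
    thus ?thesis using u by (intro exI[of _ u]) auto
  qed
qed

text \<open>Dividing n by its largest square changes no character value at units, and the primes of
  the squarefree part are exactly those of odd multiplicity in n. T says which of the characters
  modulo 4 and 8 join the distinguished product.\<close>

lemma prescribed_quad_chars:
  fixes \<epsilon> :: "nat \<Rightarrow> int"
  assumes P: "finite P" "P \<noteq> {}" "\<And>p. p \<in> P \<Longrightarrow> prime p \<and> p > 2" and T: "T \<subseteq> {1, 2}"
    and \<epsilon>: "\<And>i. i \<in> {1, 2} \<union> P \<Longrightarrow> \<epsilon> i = 1 \<or> \<epsilon> i = -1" and compatible: "(\<Prod>i\<in>T \<union> P. \<epsilon> i) = 1"
  obtains c where "c > 0" "squarefree c" "odd c" "\<And>p. p \<in> P \<Longrightarrow> \<not> p dvd c"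
    "\<And>i. i \<in> {1, 2} \<union> P \<Longrightarrow> quad_char i c = \<epsilon> i"
    "\<And>q. prime q \<Longrightarrow> q dvd c \<Longrightarrow> (\<Prod>i\<in>T \<union> P. quad_char i q) = 1"
proof -
  interpret real_characters "{1, 2} \<union> P" "\<lambda>i n. real_of_int (quad_char i n)" "8 * \<Prod>P"
    using P by (intro real_characters_quad_char) auto
  have comp: "(\<Prod>i\<in>T \<union> P. real_of_int (\<epsilon> i)) = 1" using compatible by (metis of_int_1 of_int_prod)
  have S0: "T \<union> P \<subseteq> {1, 2} \<union> P" "T \<union> P \<noteq> {}" using P T by auto
  have sign: "real_of_int (\<epsilon> i) = 1 \<or> real_of_int (\<epsilon> i) = -1" if "i \<in> {1, 2} \<union> P" for i
    using \<epsilon>[OF that] by auto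
  obtain n where n: "n > 0" "coprime n (8 * \<Prod>P)"
    "\<And>i. i \<in> {1, 2} \<union> P \<Longrightarrow> real_of_int (quad_char i n) = real_of_int (\<epsilon> i)"
    "\<And>q. prime q \<Longrightarrow> odd (multiplicity q n) \<Longrightarrow> (\<Prod>i\<in>T \<union> P. real_of_int (quad_char i q)) = 1"
    using prescribed_values[OF S0 sign comp] by metis
  define c s where "c = squarefree_part n" and "s = square_part n"
  have ncs: "n = c * s^2" unfolding c_def s_def by (rule squarefree_decompose)
  have cs: "c > 0" "s > 0" using n(1) ncs by (auto intro!: Nat.gr0I)
  have cop: "coprime c (8 * \<Prod>P)" "coprime s (8 * \<Prod>P)"
    using n(2) cs unfolding ncs by auto
  have sqf: "squarefree c" unfolding c_def by (rule squarefree_squarefree_part) 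
  show thesis
  proof (rule that[OF cs(1) sqf])
    show "odd c" using cop(1) by (rule odd_if_coprime_mult_8)
    show "\<not> p dvd c" if "p \<in> P" for p
    proof
      assume "p dvd c"
      moreover have "p dvd 8 * \<Prod>P" using that P(1) by (intro dvd_mult dvd_Prod)
      ultimately have "p dvd 1" using cop(1) by (metis coprime_common_divisor)
      thus False using P(3)[OF that] by simp
    qed
    show "quad_char i c = \<epsilon> i" if "i \<in> {1, 2} \<union> P" for i
    proof -
      have "real_of_int (quad_char i n) = real_of_int (quad_char i c) * (real_of_int (quad_char i s))^2"
        unfolding ncs by (simp only: mult[OF that] power2_eq_square)
      also have "(real_of_int (quad_char i s))^2 = 1" using unit[OF that cop(2)] by auto
      finally show ?thesis using n(3)[OF that] by simp
    qed
    show "(\<Prod>i\<in>T \<union> P. quad_char i q) = 1" if q: "prime q" "q dvd c" for q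
    proof -
      have "multiplicity q c > 0" using q cs by (simp add: prime_multiplicity_gt_zero_iff)
      moreover have "multiplicity q c = multiplicity q n mod 2"
        unfolding c_def using n(1) q by (intro prime_multiplicity_squarefree_part) auto
      ultimately have "odd (multiplicity q n)" by presburger
      from n(4)[OF q(1) this] show ?thesis by (metis of_int_1 of_int_eq_iff of_int_prod)
    qed
  qed
qed

section \<open>Ternary forms of determinant 3\<close>

text \<open>The Gram matrix has diagonal a, b, c and integral off-diagonal entries e, f, g, which
  explains the factors 2; \<open>tdet\<close> is its determinant.\<close>

definition tform :: "int \<Rightarrow> int \<Rightarrow> int \<Rightarrow> int \<Rightarrow> int \<Rightarrow> int \<Rightarrow> int \<Rightarrow> int \<Rightarrow> int \<Rightarrow> int" where
  "tform a b c e f g x y z = a * x^2 + b * y^2 + c * z^2 + 2 * e * y * z + 2 * f * x * z + 2 * g * x * y"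

definition tdet :: "int \<Rightarrow> int \<Rightarrow> int \<Rightarrow> int \<Rightarrow> int \<Rightarrow> int \<Rightarrow> int" where
  "tdet a b c e f g = a * b * c + 2 * e * f * g - a * e^2 - b * f^2 - c * g^2"

definition diag_value :: "int \<Rightarrow> bool" where
  "diag_value n \<longleftrightarrow> (\<exists>x y z. n = x^2 + y^2 + 3 * z^2)"

text \<open>Orthogonal sum of the unit lattice and the root lattice A2, with the same determinant 3
  as diag(1, 1, 3).\<close>

definition hex_value :: "int \<Rightarrow> bool" where
  "hex_value n \<longleftrightarrow> (\<exists>x z w. n = x^2 + 2 * (z^2 + z * w + w^2))"

text \<open>Completing the square in x leaves, up to the factor a, a binary form with diagonal a b -
  g^2, a c - f^2 and off-diagonal entry a e - f g; this is its determinant.\<close>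

lemma tdet_Schur: "(a * b - g^2) * (a * c - f^2) - (a * e - f * g)^2 = a * tdet a b c e f g"
  by (simp add: tdet_def power2_eq_square algebra_simps)

lemma nearest_multiple:
  fixes q p :: int
  assumes "p > 0"
  obtains t where "4 * (q + t * p)^2 \<le> p^2"
proof -
  define t where "t = - ((2 * q + p) div (2 * p))"
  have "2 * q + p = 2 * p * ((2 * q + p) div (2 * p)) + (2 * q + p) mod (2 * p)"
    by simp
  hence "2 * (q + t * p) = (2 * q + p) mod (2 * p) - p"
    by (simp add: t_def algebra_simps)
  moreover have "0 \<le> (2 * q + p) mod (2 * p)" "(2 * q + p) mod (2 * p) < 2 * p"
    using assms by simp_all
  ultimately have "\<bar>2 * (q + t * p)\<bar> \<le> \<bar>p\<bar>"
    by linarith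
  hence "(2 * (q + t * p))^2 \<le> p^2"
    by (simp add: abs_le_square_iff)
  moreover have "(2 * (q + t * p))^2 = 4 * (q + t * p)^2"
    by (simp only: power_mult_distrib) simp
  ultimately show thesis
    using that by metis
qed

text \<open>A vector of norm 1 splits off. The remaining binary form has determinant 3 and leading
  coefficient 1 or 2, which gives y^2 + 3 z^2 or 2 (y^2 + y z + z^2) after a shift of y.\<close>

lemma tform_leading_one:
  assumes p: "b - g^2 > 0" "(b - g^2)^2 \<le> 4" and det: "tdet 1 b c e f g = 3"
  shows "(\<forall>x y z. diag_value (tform 1 b c e f g x y z)) \<or> (\<forall>x y z. hex_value (tform 1 b c e f g x y z))"
proof -
  define B C E where "B = b - g^2" and "C = c - f^2" and "E = e - f * g"
  have split: "tform 1 b c e f g x y z = (x + g * y + f * z)^2 + (B * y^2 + 2 * E * y * z + C * z^2)" for x y z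
    by (simp add: tform_def B_def C_def E_def power2_eq_square algebra_simps)
  have BC: "B * C - E^2 = 3"
    using tdet_Schur[of 1 b g c f e] det by (simp add: B_def C_def E_def)
  have "B < 3"
  proof (rule ccontr)
    assume "\<not> B < 3"
    hence "3^2 \<le> B^2" by (intro power_mono) auto
    thus False using p by (simp add: B_def)
  qed
  then consider "B = 1" | "B = 2"
    using p by (fastforce simp: B_def)
  thus ?thesis
  proof cases
    case 1
    have "diag_value (tform 1 b c e f g x y z)" for x y z
    proof -
      have "C = E^2 + 3" using BC 1 by simp
      hence "tform 1 b c e f g x y z = (x + g * y + f * z)^2 + (y + E * z)^2 + 3 * z^2"
        by (simp add: split 1 power2_eq_square algebra_simps)
      thus ?thesis unfolding diag_value_def by blast
    qed
    thus ?thesis by blast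
  next
    case 2
    have "E^2 = 2 * (C - 2) + 1" using BC 2 by simp
    hence "odd (E^2)" by simp
    then obtain k where k: "E = 2 * k + 1"
      by (auto elim: oddE)
    have C: "C = 2 * k^2 + 2 * k + 2"
      using BC 2 k by (simp add: power2_eq_square algebra_simps)
    have "hex_value (tform 1 b c e f g x y z)" for x y z
    proof -
      have "tform 1 b c e f g x y z
          = (x + g * y + f * z)^2 + 2 * ((y + k * z)^2 + (y + k * z) * z + z^2)"
        by (simp add: split 2 C k power2_eq_square algebra_simps)
      thus ?thesis unfolding hex_value_def by blast
    qed
    thus ?thesis by blast
  qed
qed

text \<open>The two inequalities combine to 9 a^3 <= 64, which excludes a = 2 already.\<close>

lemma leading_bound:
  fixes a p :: int
  assumes "a > 0" "p > 0" "p^2 \<le> 4 * a" "3 * a^2 \<le> 4 * p"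
  shows "a = 1"
proof (rule ccontr)
  assume "a \<noteq> 1"
  hence a: "a \<ge> 2" using assms by simp
  have "(3 * a^2)^2 \<le> (4 * p)^2"
    using assms by (intro power_mono) auto
  also have "\<dots> \<le> 64 * a"
    using assms by (simp add: power_mult_distrib)
  finally have "a * (9 * a^3) \<le> a * 64"
    by (simp add: power_mult_distrib algebra_simps eval_nat_numeral)
  hence "9 * a^3 \<le> 64"
    using a by simp
  moreover have "2^3 \<le> a^3"
    using a by (intro power_mono) auto
  ultimately show False by simp
qed

text \<open>Lexicographic descent on the norm a of the first basis vector and the Gram determinant p
  of the first two. Shifting the third vector by a multiple of the second and swapping them lowers
  p; shifting the second by a multiple of the first and swapping lowers a. When neither helps, p^2
  <= 4a and 3a^2 <= 4p.\<close>

lemma tform_det_3: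
  assumes "a > 0" "a * b - g^2 > 0" "tdet a b c e f g = 3"
  shows "(\<forall>x y z. diag_value (tform a b c e f g x y z)) \<or> (\<forall>x y z. hex_value (tform a b c e f g x y z))"
  using assms
proof (induction "(nat a, nat (a * b - g^2))" arbitrary: a b c e f g
         rule: wf_induct_rule[OF wf_lex_prod[OF wf_less_than wf_less_than]])
  case (1 a b g c e f)
  note IH = 1(1) and a = 1(2) and p = 1(3) and det = 1(4)
  define p where "p = a * b - g^2"
  have p0: "p > 0" using p by (simp add: p_def)
  obtain t where t: "4 * (a * e - f * g + t * p)^2 \<le> p^2"
    using nearest_multiple[OF p0] by blast
  define c' e' f' where "c' = c + 2 * e * t + b * t^2" and "e' = e + b * t" and "f' = f + g * t"
  have q': "a * e' - f' * g = a * e - f * g + t * p"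
    by (simp add: e'_def f'_def p_def power2_eq_square algebra_simps)
  have det': "tdet a b c' e' f' g = 3"
    unfolding det[symmetric] by (simp add: tdet_def c'_def e'_def f'_def power2_eq_square algebra_simps)
  have schur': "p * (a * c' - f'^2) = 3 * a + (a * e' - f' * g)^2"
    using tdet_Schur[of a b g c' f' e'] det' by (simp add: p_def)
  show ?case
  proof (cases "a * c' - f'^2 < p")
    case True
    have "p * (a * c' - f'^2) > 0"
      unfolding schur' using a by (intro add_pos_nonneg) auto
    hence r0: "a * c' - f'^2 > 0"
      using p0 by (simp add: zero_less_mult_iff)
    have "tdet a c' b e' g f' = 3"
      using det' by (simp add: tdet_def algebra_simps)
    from IH[OF _ a r0 this] True r0 have
      "(\<forall>x y z. diag_value (tform a c' b e' g f' x y z)) \<or> (\<forall>x y z. hex_value (tform a c' b e' g f' x y z))"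
      by (simp add: p_def)
    moreover have "tform a b c e f g x y z = tform a c' b e' g f' x z (y - t * z)" for x y z
      by (simp add: tform_def c'_def e'_def f'_def power2_eq_square algebra_simps)
    ultimately show ?thesis by auto
  next
    case False
    \<comment> \<open>With r = a c' - f'^2 and q = a e' - f' g one has p r = 3 a + q^2; r >= p and 4
      q^2 <= p^2 then give p^2 <= 4 a.\<close>
    have "p * p \<le> p * (a * c' - f'^2)"
      using False p0 by (intro mult_left_mono) auto
    hence p_bound: "p^2 \<le> 4 * a"
      using schur' t q' by (simp add: power2_eq_square)
    obtain s where s: "4 * (g + s * a)^2 \<le> a^2"
      using nearest_multiple[OF a] by blast
    define b' g' e'' where "b' = b + 2 * g * s + a * s^2" and "g' = g + s * a" and "e'' = e + f * s"
    have p': "a * b' - g'^2 = p"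
      by (simp add: b'_def g'_def p_def power2_eq_square algebra_simps)
    have ab: "a * b' > 0"
      using p' p0 by (smt (verit) zero_le_power2)
    hence b0: "b' > 0" using a by (simp add: zero_less_mult_iff)
    show ?thesis
    proof (cases "b' < a")
      case True
      have d: "tdet b' a c f e'' g' = 3"
        unfolding det[symmetric] by (simp add: tdet_def b'_def g'_def e''_def power2_eq_square algebra_simps)
      have "b' * a - g'^2 > 0" using p' p0 by (simp add: mult.commute)
      from IH[OF _ b0 this d] True a have
        "(\<forall>x y z. diag_value (tform b' a c f e'' g' x y z)) \<or> (\<forall>x y z. hex_value (tform b' a c f e'' g' x y z))"
        by simp
      moreover have "tform a b c e f g x y z = tform b' a c f e'' g' y (x - s * y) z" for x y z
        by (simp add: tform_def b'_def g'_def e''_def power2_eq_square algebra_simps)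
      ultimately show ?thesis by auto
    next
      case False
      have "a * a \<le> a * b'"
        using False a by (intro mult_left_mono) auto
      hence "3 * a^2 \<le> 4 * p"
        using s p' by (simp add: g'_def power2_eq_square)
      hence "a = 1"
        using leading_bound a p0 p_bound by blast
      thus ?thesis
        using tform_leading_one[of b g c e f] p0 p_bound det by (simp add: p_def)
    qed
  qed
qed

lemma square_residue_mod_9:
  fixes t :: int
  assumes "t mod 3 = 1"
  obtains s where "s^2 mod 9 = t mod 9"
proof -
  have "t mod 9 = 1 \<or> t mod 9 = 4 \<or> t mod 9 = 7"
    using assms by presburger
  thus thesis
    using that[of 1] that[of 2] that[of 4] by auto
qed

text \<open>Modulo 3 the form x^2 + y^2 is anisotropic, so x and y are divisible by 3 and z^2 would
  be 2 modulo 3.\<close>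

lemma not_diag_value:
  assumes "n mod 9 = 6"
  shows "\<not> diag_value n"
proof
  assume "diag_value n"
  then obtain x y z where n: "n = x^2 + y^2 + 3 * z^2"
    unfolding diag_value_def by blast
  have sq3: "u^2 mod 3 = (if u mod 3 = 0 then 0 else 1)" for u :: int
  proof -
    have "u mod 3 = 0 \<or> u mod 3 = 1 \<or> u mod 3 = 2" by presburger
    thus ?thesis using power_mod[of u 3 2] by auto
  qed
  have "(x^2 + y^2) mod 3 = 0"
    using assms n by presburger
  hence "(x^2 mod 3 + y^2 mod 3) mod 3 = 0" by (simp add: mod_simps)
  hence "x mod 3 = 0 \<and> y mod 3 = 0"
    by (auto simp: sq3 split: if_splits)
  then obtain x' y' where "x = 3 * x'" "y = 3 * y'"
    by (meson dvdE mod_eq_0_iff_dvd)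
  hence "n = 9 * (x'^2 + y'^2) + 3 * z^2"
    using n by (simp add: power_mult_distrib)
  hence "z^2 mod 3 = 2"
    using assms by presburger
  thus False using sq3[of z] by (auto split: if_splits)
qed

text \<open>The Gram matrix with rows \<open>(a, k, 0)\<close>, \<open>(k, c, h)\<close>, \<open>(0, h, m)\<close> has determinant 3 and
  represents \<open>m\<close>; the congruence \<open>m c \<equiv> 2 (mod 3)\<close> makes it isotropic modulo 3, so that it
  represents a number that is 6 modulo 9 and is not equivalent to \<open>x\<^sup>2 + y\<^sup>2 + 3 z\<^sup>2\<close>.\<close>

lemma hex_value_if_residues:
  assumes m: "m > 0" and c: "c > 0" and mc: "m * c mod 3 = 2" and cop: "coprime m c"
    and h: "\<exists>h. m dvd c * h^2 + 3" and k: "\<exists>k. c dvd k^2 + 3 * m"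
  shows "hex_value m"
proof -
  have m3: "\<not> 3 dvd m" "\<not> 3 dvd c"
    using mc by auto
  \<comment> \<open>Replacing h by h + m, with m prime to 3, preserves the divisibility and makes h
    prime to 3.\<close>
  obtain h where h: "m dvd c * h^2 + 3" and h3: "\<not> 3 dvd h"
  proof -
    obtain h where h: "m dvd c * h^2 + 3" using assms by blast
    show ?thesis
    proof (cases "3 dvd h")
      case True
      hence "\<not> 3 dvd h + m" using m3 by (simp add: dvd_add_right_iff)
      moreover have "c * (h + m)^2 + 3 = (c * h^2 + 3) + m * (c * (2 * h + m))"
        by (simp add: power2_eq_square algebra_simps)
      hence "m dvd c * (h + m)^2 + 3" using h by (simp only: dvd_add dvd_triv_left)
      ultimately show ?thesis using that by blast
    qed (use h that in blast)
  qed
  obtain d where d: "c * h^2 + 3 = m * d" using h by blast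
  have "m * d > 0" unfolding d[symmetric] using c by (intro add_nonneg_pos) auto
  hence d0: "d > 0" using m by (simp add: zero_less_mult_iff)
  have "[h^2 = 1] (mod 3)"
  proof -
    have "h mod 3 = 1 \<or> h mod 3 = 2" using h3 by presburger
    thus ?thesis unfolding cong_def using power_mod[of h 3 2] by auto
  qed
  hence "[m * (c * h^2 + 3) = m * (c * 1 + 0)] (mod 3)"
    by (intro cong_mult cong_add cong_refl) (auto simp: cong_def)
  moreover have "m * (c * h^2 + 3) = m^2 * d"
    by (simp only: d) (simp add: power2_eq_square)
  ultimately have "[m^2 * d = 2] (mod 3)"
    using mc by (simp add: cong_def)
  moreover have "[m^2 * d = 1 * d] (mod 3)"
  proof -
    have "m mod 3 = 1 \<or> m mod 3 = 2" using m3 by presburger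
    hence "[m^2 = 1] (mod 3)" unfolding cong_def using power_mod[of m 3 2] by auto
    thus ?thesis by (rule cong_mult) simp
  qed
  ultimately have d3: "d mod 3 = 2" by (simp add: cong_def)
  \<comment> \<open>Modulo c one has m d = 3, so dividing a square root of -3m by m gives a square
    root of -d.\<close>
  obtain k where k: "c dvd k^2 + d"
  proof -
    obtain k where k: "c dvd k^2 + 3 * m" using assms by blast
    obtain u where u: "[m * u = 1] (mod c)"
      using cong_solve_coprime_int[OF cop] by blast
    have "m^2 * ((u * k)^2 + d) = (m * u)^2 * k^2 + m * (m * d)"
      by (simp add: power2_eq_square algebra_simps)
    also have "\<dots> = (m * u)^2 * k^2 + m * (c * h^2 + 3)"
      by (simp only: d)
    also have "[(m * u)^2 * k^2 + m * (c * h^2 + 3) = 1^2 * k^2 + m * (0 * h^2 + 3)] (mod c)"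
      by (intro cong_add cong_mult cong_pow u cong_refl) (simp add: cong_def)
    also have "[1^2 * k^2 + m * (0 * h^2 + 3) = 0] (mod c)"
      using k by (simp add: cong_0_iff mult.commute)
    finally have "c dvd m^2 * ((u * k)^2 + d)"
      by (simp add: cong_0_iff)
    hence "c dvd (u * k)^2 + d"
      using cop by (simp add: coprime_dvd_mult_right_iff coprime_commute)
    thus ?thesis using that by blast
  qed
  then obtain a where a: "k^2 + d = c * a" by blast
  have "c * a > 0" unfolding a[symmetric] using d0 by (intro add_nonneg_pos) auto
  hence a0: "a > 0" using c by (simp add: zero_less_mult_iff)
  have ac: "a * c - k^2 = d" using a by (simp add: algebra_simps)
  have "tdet a c m 0 h k = m * (a * c - k^2) - c * h^2"
    by (simp add: tdet_def algebra_simps)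
  hence det: "tdet a c m 0 h k = 3"
    using d by (simp add: ac)
  have "\<not> (\<forall>x y z. diag_value (tform a c m 0 h k x y z))"
  proof -
    \<comment> \<open>At z = 0 and x = 1, c times the value is (c y + k)^2 + d. To get 6 modulo 9,
      6c - d must be a square modulo 9, and it is one since -d is 1 modulo 3.\<close>
    have "(6 * c - d) mod 3 = 1" using d3 by presburger
    then obtain s where s: "[s^2 = 6 * c - d] (mod 9)"
      using square_residue_mod_9[of "6 * c - d"] by (metis cong_def)
    have "coprime c 3"
      using m3 prime_imp_coprime[of "3 :: int" c] by (simp add: coprime_commute)
    hence "coprime c (3^2)"
      by (subst coprime_power_right_iff) simp
    hence c9: "coprime c 9" by simp
    obtain u where u: "[c * u = 1] (mod 9)"
      using cong_solve_coprime_int[OF c9] by blast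
    define y where "y = u * (s - k)"
    have y: "[c * y + k = s] (mod 9)"
    proof -
      have "[c * u * (s - k) + k = 1 * (s - k) + k] (mod 9)"
        by (intro cong_add cong_mult u cong_refl)
      thus ?thesis by (simp add: y_def mult.assoc)
    qed
    have "c * tform a c m 0 h k 1 y 0 = (c * y + k)^2 + d"
      by (simp add: tform_def ac[symmetric] power2_eq_square algebra_simps)
    also have "[\<dots> = (6 * c - d) + d] (mod 9)"
      by (intro cong_add cong_refl cong_trans[OF cong_pow[OF y] s])
    finally have "[c * tform a c m 0 h k 1 y 0 = c * 6] (mod 9)"
      by (simp add: mult.commute)
    hence "[tform a c m 0 h k 1 y 0 = 6] (mod 9)"
      using c9 by (simp add: cong_mult_lcancel)
    thus ?thesis
      using not_diag_value by (auto simp: cong_def)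
  qed
  hence "hex_value (tform a c m 0 h k 0 0 1)"
    using tform_det_3[OF a0 _ det] ac d0 by auto
  thus ?thesis by (simp add: tform_def)
qed

section \<open>Values of the hexagonal ternary form\<close>

lemma mod_3_if_Legendre:
  assumes "Legendre a 3 = -1"
  shows "a mod 3 = 2"
proof -
  have "a mod 3 = 0 \<or> a mod 3 = 1 \<or> a mod 3 = 2" by presburger
  moreover have "a mod 3 \<noteq> 0" using assms Legendre_eq_0_iff[of a 3] by auto
  moreover have "a mod 3 \<noteq> 1"
  proof
    assume "a mod 3 = 1"
    hence "Legendre a 3 = Legendre 1 3" by (intro Legendre_cong) (simp add: cong_def)
    thus False using assms Legendre_one[of 3] by simp
  qed
  ultimately show ?thesis by blast
qed

text \<open>The roots modulo the prime factors are glued by the Chinese remainder theorem; at the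
  prime 2 the root 1 always works because m and c are coprime.\<close>

lemma hex_value_if_Legendre:
  fixes m c :: nat
  assumes sqf: "squarefree m" "squarefree c" and cop: "coprime m c"
    and mc: "Legendre (m * c) 3 = -1"
    and m: "\<And>p. prime p \<Longrightarrow> p > 2 \<Longrightarrow> p dvd m \<Longrightarrow> Legendre (-3 * int c) p = 1"
    and c: "\<And>p. prime p \<Longrightarrow> p > 2 \<Longrightarrow> p dvd c \<Longrightarrow> Legendre (-3 * int m) p = 1"
  shows "hex_value m"
proof (rule hex_value_if_residues)
  show "int m > 0" "int c > 0" using sqf by (auto intro!: Nat.gr0I)
  show "int m * int c mod 3 = 2" using mod_3_if_Legendre[OF mc] by simp
  show "coprime (int m) (int c)" using cop by simp
  show "\<exists>h. int m dvd int c * h^2 + 3"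
  proof (rule squarefree_root[OF sqf(1)])
    fix p assume p: "prime p" "p dvd m"
    show "\<exists>x. int p dvd int c * x^2 + 3"
    proof (cases "p = 2")
      case True
      hence "odd c" using p cop coprime_common_divisor[of m c 2] by auto
      thus ?thesis using True by (intro exI[of _ 1]) simp
    next
      case False
      hence "p > 2" using prime_ge_2_nat[OF p(1)] by simp
      hence "Legendre (- (int c * 3)) p = 1" using m[OF p(1) _ p(2)] by (simp add: mult.commute)
      thus ?thesis using Legendre_one_imp_root p(1) by blast
    qed
  qed
  have "\<exists>k. int c dvd 1 * k^2 + 3 * int m"
  proof (rule squarefree_root[OF sqf(2)])
    fix p assume p: "prime p" "p dvd c"
    show "\<exists>x. int p dvd 1 * x^2 + 3 * int m"
    proof (cases "p = 2")
      case True
      hence "odd m" using p cop coprime_common_divisor[of m c 2] by auto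
      thus ?thesis using True by (intro exI[of _ 1]) simp
    next
      case False
      hence "p > 2" using prime_ge_2_nat[OF p(1)] by simp
      hence "Legendre (- (1 * (3 * int m))) p = 1" using c[OF p(1) _ p(2)] by simp
      thus ?thesis using Legendre_one_imp_root p(1) by blast
    qed
  qed
  thus "\<exists>k. int c dvd k^2 + 3 * int m" by simp
qed

section \<open>Choosing the auxiliary number c\<close>

lemma squarefree_prod_prime_factors:
  fixes n :: nat
  assumes "squarefree n"
  shows "\<Prod>(prime_factors n) = n"
proof -
  have "n \<noteq> 0" using assms by (metis not_squarefree_0)
  hence "(\<Prod>p\<in>prime_factors n. p ^ multiplicity p n) = n"
    using prod_prime_factors[of n] by simp
  moreover have "(\<Prod>p\<in>prime_factors n. p ^ multiplicity p n) = (\<Prod>p\<in>prime_factors n. p)"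
    using assms \<open>n \<noteq> 0\<close> by (intro prod.cong) (auto simp: squarefree_factorial_semiring')
  ultimately show ?thesis by simp
qed

lemma odd_prime_factor_gt_2:
  fixes n :: nat
  assumes "odd n" "prime p" "p dvd n"
  shows "p > 2"
  using assms prime_ge_2_nat[of p] by (cases "p = 2") auto

lemma Legendre_2_3: "Legendre 2 3 = -1"
  using Legendre_two[of 3] by (simp add: \<chi>8_def)

text \<open>The candidate \<open>c = e * k\<close> has \<open>\<chi>4 k = \<delta>\<close> and \<open>\<chi>8 k = 1\<close>; the last hypothesis is the
  product formula for the characters defining the Legendre symbol of \<open>-3 f m\<close>.\<close>

lemma hex_value_mult_squarefree:
  fixes m e f :: nat and \<delta> :: int
  assumes sqf: "squarefree m" and odd: "odd m" and m3: "\<not> 3 dvd m"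
    and ef: "(e, f) \<in> {(1, 1), (2, 1), (1, 2)}" and \<delta>: "\<delta> = 1 \<or> \<delta> = -1"
    and product: "(if \<chi>4 m = -1 then \<delta> else 1) * (- Legendre (e * f) 3) * (if e = 2 then \<chi>8 m else 1) = 1"
  shows "hex_value (f * m)"
proof -
  define P where "P = insert 3 (prime_factors m)"
  \<comment> \<open>Reciprocity over P yields the symbol of -\<open>\<chi>4 m\<close> 3m at q. Index
    1 removes the sign \<open>\<chi>4 m\<close>, index 2 supplies the factor f = 2, so the full
    product is the symbol of -3 f m.\<close>
  define T :: "nat set" where "T = (if \<chi>4 m = -1 then {1} else {}) \<union> (if f = 2 then {2} else {})"
  \<comment> \<open>At 3 the sign makes f m c equal to 2 modulo 3; at p dividing m it makes -3 c a
    residue.\<close>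
  define \<epsilon> where "\<epsilon> = (\<lambda>i. if i = 1 then \<delta> else if i = 2 then 1
    else if i = 3 then - Legendre (e * f * m) 3 else Legendre (-3 * int e) i)"
  have m0: "m > 0" using odd by (auto intro!: Nat.gr0I)
  have factors: "prime p" "p dvd m" "p > 2" "p \<noteq> 3" if "p \<in> prime_factors m" for p
    using that odd_prime_factor_gt_2[OF odd] m3 by auto
  have P: "finite P" "P \<noteq> {}" "\<And>p. p \<in> P \<Longrightarrow> prime p \<and> p > 2"
    using factors by (auto simp: P_def)
  have T: "T \<subseteq> {1, 2}" by (simp add: T_def)
  have "p \<notin> P" if "p \<in> T" for p using T P(3)[of p] that by auto
  hence TP: "T \<inter> P = {}" by blast
  have not3: "3 \<notin> prime_factors m" using m3 by auto
  have prodP: "\<Prod>P = 3 * m"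
    using not3 squarefree_prod_prime_factors[OF sqf] by (simp add: P_def)
  have "\<not> 3 dvd e * f" using ef by auto
  hence "\<not> 3 dvd e * f * m"
    using m3 prime_dvd_mult_iff[of 3 "e * f" m] by simp
  hence efm3: "\<not> int 3 dvd int (e * f * m)"
    unfolding int_dvd_int_iff .
  have sign: "\<epsilon> i = 1 \<or> \<epsilon> i = -1" if i: "i \<in> {1, 2} \<union> P" for i
  proof -
    consider "i = 1" | "i = 2" | "i = 3" | "i \<in> prime_factors m" "i \<noteq> 3"
      using i unfolding P_def by blast
    thus ?thesis
    proof cases
      case 3
      thus ?thesis using Legendre_unit[OF efm3] by (auto simp: \<epsilon>_def)
    next
      case 4
      have "\<not> i dvd 3" using factors[OF 4(1)] primes_dvd_imp_eq[of i 3] by auto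
      moreover have "\<not> i dvd e" using factors[OF 4(1)] ef by (auto dest: dvd_imp_le)
      ultimately have "\<not> i dvd 3 * e" using factors[OF 4(1)] by (simp add: prime_dvd_mult_iff)
      hence "\<not> int i dvd -3 * int e"
        by (metis dvd_minus_iff int_dvd_int_iff minus_mult_left of_nat_mult of_nat_numeral)
      thus ?thesis using Legendre_unit factors[OF 4(1)] 4 by (auto simp: \<epsilon>_def)
    qed (use \<delta> in \<open>auto simp: \<epsilon>_def\<close>)
  qed
  have compatible: "(\<Prod>i\<in>T \<union> P. \<epsilon> i) = 1"
  proof -
    \<comment> \<open>Since (-3 / p) = (p / 3), the primes of m contribute (m / 3), which cancels
      against the same factor in \<open>\<epsilon> 3\<close>.\<close>
    have "(\<Prod>i\<in>prime_factors m. \<epsilon> i) = (\<Prod>p\<in>prime_factors m. Legendre p 3 * (if e = 2 then \<chi>8 p else 1))"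
    proof (rule prod.cong)
      fix p assume p: "p \<in> prime_factors m"
      have "Legendre p 3 = Legendre (-3) p"
        using Legendre_reciprocity[of 3 p] factors[OF p] by (simp add: \<chi>4_def)
      moreover have "Legendre (-3 * int e) p = Legendre (-3) p * Legendre e p"
        using factors[OF p] by (intro Legendre_mult)
      moreover have "Legendre e p = (if e = 2 then \<chi>8 p else 1)"
        using ef factors[OF p] Legendre_two[of p] Legendre_one[of p] by auto
      ultimately show "\<epsilon> p = Legendre p 3 * (if e = 2 then \<chi>8 p else 1)"
        using factors[OF p] by (simp add: \<epsilon>_def)
    qed simp
    also have "\<dots> = (\<Prod>p\<in>prime_factors m. Legendre p 3) * (\<Prod>p\<in>prime_factors m. if e = 2 then \<chi>8 p else 1)"
      by (rule prod.distrib)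
    also have "(\<Prod>p\<in>prime_factors m. Legendre p 3) = Legendre m 3"
      using Legendre_prod[of "prime_factors m" 3 int] squarefree_prod_prime_factors[OF sqf]
      by (simp flip: of_nat_prod)
    also have "(\<Prod>p\<in>prime_factors m. if e = 2 then \<chi>8 p else 1) = (if e = 2 then \<chi>8 m else 1)"
      using \<chi>8_prod[of "prime_factors m"] squarefree_prod_prime_factors[OF sqf] by simp
    finally have primes: "(\<Prod>i\<in>prime_factors m. \<epsilon> i) = Legendre m 3 * (if e = 2 then \<chi>8 m else 1)" .
    have "(\<Prod>i\<in>T. \<epsilon> i) = (if \<chi>4 m = -1 then \<delta> else 1)"
      by (auto simp: T_def \<epsilon>_def)
    moreover have "\<epsilon> 3 = - (Legendre (e * f) 3 * Legendre m 3)"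
      using Legendre_mult[of 3 "int (e * f)" m] by (simp add: \<epsilon>_def)
    moreover have "\<not> int 3 dvd int m" using m3 by (simp only: int_dvd_int_iff) simp
    hence "Legendre m 3 * Legendre m 3 = 1"
      using Legendre_square[of 3 m] by simp
    ultimately have "(\<Prod>i\<in>T. \<epsilon> i) * (\<epsilon> 3 * (\<Prod>i\<in>prime_factors m. \<epsilon> i)) = 1"
      using product primes by (simp add: algebra_simps)
    moreover have "(\<Prod>i\<in>T \<union> P. \<epsilon> i) = (\<Prod>i\<in>T. \<epsilon> i) * (\<Prod>i\<in>P. \<epsilon> i)"
      using TP P(1) T by (intro prod.union_disjoint) (auto intro: finite_subset)
    moreover have "(\<Prod>i\<in>P. \<epsilon> i) = \<epsilon> 3 * (\<Prod>i\<in>prime_factors m. \<epsilon> i)"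
      using not3 by (simp add: P_def)
    ultimately show ?thesis by simp
  qed
  obtain k where k: "k > 0" "squarefree k" "odd k" "\<And>p. p \<in> P \<Longrightarrow> \<not> p dvd k"
    "\<And>i. i \<in> {1, 2} \<union> P \<Longrightarrow> quad_char i k = \<epsilon> i"
    "\<And>q. prime q \<Longrightarrow> q dvd k \<Longrightarrow> (\<Prod>i\<in>T \<union> P. quad_char i q) = 1"
    using prescribed_quad_chars[OF P T sign compatible] by metis
  have cop_mk: "coprime m k"
  proof (rule ccontr)
    assume "\<not> coprime m k"
    hence "gcd m k \<noteq> 1" by (simp only: coprime_iff_gcd_eq_1 not_False_eq_True)
    then obtain p where p: "prime p" "p dvd gcd m k"
      using prime_factor_nat by blast
    hence "p \<in> P" using m0 by (simp add: P_def in_prime_factors_iff)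
    thus False using k(4) p(2) by simp
  qed
  have sqf_ef: "squarefree e" "squarefree f"
    using ef squarefree_prime[of "2::nat"] by auto
  have cop: "coprime f m" "coprime e k" "coprime f k" "coprime m e" "coprime f e"
    using ef odd k(3) by auto
  have k3: "Legendre k 3 = - Legendre (e * f * m) 3"
    using k(5)[of 3] by (simp add: P_def \<epsilon>_def quad_char_def)
  show ?thesis
  proof (rule hex_value_if_Legendre[where c = "e * k"])
    show "squarefree (f * m)" "squarefree (e * k)"
      using squarefree_mult_coprime sqf_ef sqf k(2) cop by blast+
    show "coprime (f * m) (e * k)"
      using cop cop_mk by simp
    have "Legendre (int (e * f * m) * int k) 3 = Legendre (e * f * m) 3 * Legendre k 3"
      using Legendre_mult[of 3] by simp
    also have "\<dots> = -1" using k3 Legendre_unit[OF efm3] by auto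
    finally show "Legendre (int (f * m * (e * k))) 3 = -1" by (simp add: mult_ac)
  next
    fix p assume p: "prime p" "p > 2" "p dvd f * m"
    hence "\<not> p dvd f" using ef by (auto dest: dvd_imp_le)
    hence pm: "p \<in> prime_factors m" using p m0 by (auto simp: prime_dvd_mult_iff in_prime_factors_iff)
    have pk: "\<not> p dvd k" using k(4)[of p] pm by (simp add: P_def)
    have "Legendre k p = Legendre (-3 * int e) p"
      using k(5)[of p] pm factors[OF pm] by (simp add: P_def \<epsilon>_def quad_char_def)
    moreover have "Legendre (-3 * int (e * k)) p = Legendre (-3 * int e) p * Legendre k p"
      using Legendre_mult[OF p(1,2), of "-3 * int e" k] by (simp add: mult_ac)
    ultimately show "Legendre (-3 * int (e * k)) p = 1"
      using Legendre_square[OF p(1,2), of k] pk by simp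
  next
    fix q assume q: "prime q" "q > 2" "q dvd e * k"
    hence "\<not> q dvd e" using ef by (auto dest: dvd_imp_le)
    hence qk: "q dvd k" using q by (simp add: prime_dvd_mult_iff)
    hence qP: "q \<notin> P" using k(4) by blast
    have "(\<Prod>i\<in>T \<union> P. quad_char i q) = (\<Prod>i\<in>T. quad_char i q) * (\<Prod>p\<in>P. quad_char p q)"
      using TP P(1) T by (intro prod.union_disjoint) (auto intro: finite_subset)
    moreover have "(\<Prod>p\<in>P. quad_char p q) = (\<Prod>p\<in>P. Legendre q p)"
      using P(3) by (intro prod.cong) (auto simp: quad_char_odd_prime)
    moreover have "(\<Prod>p\<in>P. Legendre q p) = Legendre (- (\<chi>4 m * (3 * int m))) q"
      using prod_Legendre_reciprocity[OF P(1,3) q(1,2) qP] by (simp add: prodP \<chi>4_mult) (simp add: \<chi>4_def)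
    moreover have "(\<Prod>i\<in>T. quad_char i q) = Legendre (\<chi>4 m * f) q"
    proof -
      have "(\<Prod>i\<in>T. quad_char i q) = (if \<chi>4 m = -1 then \<chi>4 q else 1) * (if f = 2 then \<chi>8 q else 1)"
        by (auto simp: T_def quad_char_def)
      also have "(if \<chi>4 m = -1 then \<chi>4 q else 1) = Legendre (\<chi>4 m) q"
        using \<chi>4_unit[OF odd] Legendre_minus_one[OF q(1,2)] Legendre_one[OF q(1)] by auto
      also have "(if f = 2 then \<chi>8 q else 1) = Legendre f q"
        using ef Legendre_two[OF q(1,2)] Legendre_one[OF q(1)] by auto
      finally show ?thesis using Legendre_mult[OF q(1,2)] by simp
    qed
    ultimately have "Legendre (\<chi>4 m * f) q * Legendre (- (\<chi>4 m * (3 * int m))) q = 1"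
      using k(6)[OF q(1) qk] by simp
    hence "Legendre ((\<chi>4 m * f) * - (\<chi>4 m * (3 * int m))) q = 1"
      by (simp only: Legendre_mult[OF q(1,2), of "\<chi>4 m * int f" "- (\<chi>4 m * (3 * int m))"])
    moreover have "(\<chi>4 m * f) * - (\<chi>4 m * (3 * int m)) = -3 * int (f * m)"
      using \<chi>4_unit[OF odd] by auto
    ultimately show "Legendre (-3 * int (f * m)) q = 1" by metis
  qed
qed

text \<open>Without help the product would be -1. For m = 3 modulo 4 the sign \<delta> = -1 repairs
  it; for m = 1 modulo 8 or even m, a factor 2 in c or in m does, because (2 / 3) = -1.\<close>

lemma hex_value_squarefree:
  fixes m :: nat
  assumes sqf: "squarefree m" and m3: "\<not> 3 dvd m" and m8: "m mod 8 \<noteq> 5"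
  shows "hex_value m"
proof (cases "odd m")
  case True
  show ?thesis
  proof (cases "m mod 4 = 3")
    case True
    have "Legendre 1 3 = 1" using Legendre_one[of 3] by simp
    moreover have "odd m" "\<chi>4 m = -1" using True by (presburger, simp add: \<chi>4_def)
    ultimately show ?thesis
      using hex_value_mult_squarefree[of m 1 1 "-1"] sqf m3 by simp
  next
    case False
    hence "m mod 8 = 1" "m mod 4 = 1" using \<open>odd m\<close> m8 by presburger+
    thus ?thesis
      using hex_value_mult_squarefree[of m 2 1 1] sqf m3 \<open>odd m\<close> by (simp add: Legendre_2_3 \<chi>8_def)
  qed
next
  case False
  then obtain k where k: "m = 2 * k" by blast
  have "\<not> 2^2 dvd m"
    using sqf by (metis squarefreeD not_prime_unit two_is_prime_nat)
  hence "odd k" by (auto simp: k)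
  moreover have "squarefree k" using sqf k squarefree_multD(2) by blast
  moreover have "\<not> 3 dvd k" using m3 k by auto
  ultimately show ?thesis
    using hex_value_mult_squarefree[of k 1 2 1] by (simp add: Legendre_2_3 k)
qed

section \<open>Universal quaternary forms\<close>

text \<open>As 4 does not divide m, the square part s is odd and s^2 is 1 modulo 8, so the
  squarefree part keeps the residue modulo 8; scaling by s returns to m.\<close>

lemma hex_value_if_mod:
  fixes m :: int
  assumes "m > 0" "m mod 3 \<noteq> 0" "m mod 8 = 1 \<or> m mod 8 = 2 \<or> m mod 8 = 3 \<or> m mod 8 = 6 \<or> m mod 8 = 7"
  shows "hex_value m"
proof -
  define k c s where "k = nat m" and "c = squarefree_part k" and "s = square_part k"
  have k: "m = int k" "k > 0" using assms(1) by (simp_all add: k_def)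
  have kcs: "k = c * s^2" unfolding c_def s_def by (rule squarefree_decompose)
  have i8: "m mod 8 = int (k mod 8)" and i3: "m mod 3 = int (k mod 3)"
    by (simp_all add: k zmod_int)
  have k8: "k mod 8 \<in> {1, 2, 3, 6, 7}" using assms(3) unfolding i8 by auto
  have k3: "\<not> 3 dvd k" using assms(2) unfolding i3 by (simp add: mod_eq_0_iff_dvd)
  have "odd s"
  proof
    assume "even s"
    then obtain t where "s = 2 * t" by blast
    hence "k = 4 * (c * t^2)" by (simp add: kcs power_mult_distrib)
    then obtain u where "k = 4 * u" by blast
    hence "k mod 8 = 0 \<or> k mod 8 = 4" by presburger
    thus False using k8 by auto
  qed
  then obtain t where "s = 2 * t + 1" by (elim oddE)
  moreover have "even (t * (t + 1))" by simp
  then obtain v where "t * (t + 1) = 2 * v" by blast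
  ultimately have "s^2 = 8 * v + 1" by (simp add: power2_eq_square algebra_simps)
  hence "k = c + 8 * (c * v)" by (simp add: kcs algebra_simps)
  hence "c mod 8 \<noteq> 5" using k8 by auto
  moreover have "\<not> 3 dvd c"
    using k3 by (auto simp: kcs)
  moreover have "squarefree c" unfolding c_def by (rule squarefree_squarefree_part)
  ultimately have "hex_value (int c)" using hex_value_squarefree by blast
  then obtain x z w where "int c = x^2 + 2 * (z^2 + z * w + w^2)" unfolding hex_value_def by blast
  hence "m = (int s * x)^2 + 2 * ((int s * z)^2 + (int s * z) * (int s * w) + (int s * w)^2)"
    by (simp add: k kcs power2_eq_square algebra_simps)
  thus ?thesis unfolding hex_value_def by blast
qed

section \<open>The forms with b = 1, 2, 4, 5 by residues modulo 24\<close>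

definition represented :: "int \<Rightarrow> int \<Rightarrow> bool" where
  "represented b n \<longleftrightarrow> (\<exists>x y z w. n = x^2 + b * y^2 + 2 * (z^2 + z * w + w^2))"

lemma representedI: "n = x^2 + b * y^2 + 2 * (z^2 + z * w + w^2) \<Longrightarrow> represented b n"
  unfolding represented_def by blast

text \<open>The ten residues are those prime to 3 and equal to 1, 2, 3, 6 or 7 modulo 8.\<close>

lemma represented_if_mod_24:
  assumes n: "n mod 24 \<in> R" and d: "d = b * y^2" "d < n"
    and R: "\<forall>r\<in>R. (r - d) mod 24 \<in> {1, 2, 7, 10, 11, 14, 17, 19, 22, 23}"
  shows "represented b n"
proof -
  define m where "m = n - d"
  define r where "r = m mod 24"
  have "r \<in> {1, 2, 7, 10, 11, 14, 17, 19, 22, 23}"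
    using R n unfolding r_def m_def by (metis mod_diff_left_eq)
  moreover have "m mod 3 = r mod 3" "m mod 8 = r mod 8"
    unfolding r_def by (simp_all add: mod_mod_cancel)
  ultimately have "m mod 3 \<noteq> 0"
    "m mod 8 = 1 \<or> m mod 8 = 2 \<or> m mod 8 = 3 \<or> m mod 8 = 6 \<or> m mod 8 = 7"
    by auto
  hence "hex_value m"
    using d(2) by (intro hex_value_if_mod) (simp_all add: m_def)
  then obtain x z w where "m = x^2 + 2 * (z^2 + z * w + w^2)"
    unfolding hex_value_def by blast
  hence "n = x^2 + b * y^2 + 2 * (z^2 + z * w + w^2)" by (simp add: m_def d(1))
  thus ?thesis by (rule representedI)
qed

lemma mod_24_cases:
  fixes n :: int
  assumes "n mod 4 \<noteq> 0"
  shows "n mod 24 \<in> {1, 2, 3, 5, 6, 7, 9, 10, 11, 13, 14, 15, 17, 18, 19, 21, 22, 23}"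
proof -
  have "n mod 24 mod 4 = n mod 4" by (simp add: mod_mod_cancel)
  moreover have "0 \<le> n mod 24" "n mod 24 < 24" by simp_all
  moreover define k where "k = n mod 24"
  ultimately show ?thesis using assms unfolding k_def[symmetric] insert_iff empty_iff by presburger
qed

text \<open>For each residue class a y is chosen that moves n - b y^2 into a good class; the
  finitely many n of the class below b y^2 get explicit representations. The other values of b
  follow the same pattern.\<close>

lemma represented_1:
  assumes "n > 0" "n mod 4 \<noteq> 0"
  shows "represented 1 n"
proof -
  consider "n mod 24 \<in> {1, 2, 7, 10, 11, 14, 17, 19, 22, 23}"
    | "n mod 24 \<in> {3, 15, 18}"
    | "n mod 24 \<in> {5, 6, 21}"
    | "n mod 24 \<in> {9}"
    | "n mod 24 \<in> {13}"
    using mod_24_cases[OF assms(2)] by auto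
  thus ?thesis
  proof cases
    case 1
    thus ?thesis using assms(1) by (intro represented_if_mod_24[where y = 0 and d = 0, OF 1]) simp_all
  next
    case 2
    hence "n > 1" using assms(1) unfolding insert_iff empty_iff by presburger
    thus ?thesis by (intro represented_if_mod_24[where y = 1 and d = 1, OF 2]) simp_all
  next
    case 3
    hence "n > 4" using assms(1) unfolding insert_iff empty_iff by presburger
    thus ?thesis by (intro represented_if_mod_24[where y = 2 and d = 4, OF 3]) simp_all
  next
    case 4
    hence "n > 16 \<or> n = 9"
      using assms(1) unfolding insert_iff empty_iff by presburger
    thus ?thesis
    proof (elim disjE)
      assume "n > 16"
      thus ?thesis by (intro represented_if_mod_24[where y = 4 and d = 16, OF 4]) simp_all
    qed (use representedI[of 9 0 1 1 0 2] in simp_all)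
  next
    case 5
    hence "n > 36 \<or> n = 13"
      using assms(1) unfolding insert_iff empty_iff by presburger
    thus ?thesis
    proof (elim disjE)
      assume "n > 36"
      thus ?thesis by (intro represented_if_mod_24[where y = 6 and d = 36, OF 5]) simp_all
    qed (use representedI[of 13 1 1 2 0 2] in simp_all)
  qed
qed

lemma represented_2:
  assumes "n > 0" "n mod 4 \<noteq> 0"
  shows "represented 2 n"
proof -
  consider "n mod 24 \<in> {1, 2, 7, 10, 11, 14, 17, 19, 22, 23}"
    | "n mod 24 \<in> {3, 9, 13, 21}"
    | "n mod 24 \<in> {6, 15, 18}"
    | "n mod 24 \<in> {5}"
    using mod_24_cases[OF assms(2)] by auto
  thus ?thesis
  proof cases
    case 1
    thus ?thesis using assms(1) by (intro represented_if_mod_24[where y = 0 and d = 0, OF 1]) simp_all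
  next
    case 2
    hence "n > 2" using assms(1) unfolding insert_iff empty_iff by presburger
    thus ?thesis by (intro represented_if_mod_24[where y = 1 and d = 2, OF 2]) simp_all
  next
    case 3
    hence "n > 8 \<or> n = 6"
      using assms(1) unfolding insert_iff empty_iff by presburger
    thus ?thesis
    proof (elim disjE)
      assume "n > 8"
      thus ?thesis by (intro represented_if_mod_24[where y = 2 and d = 8, OF 3]) simp_all
    qed (use representedI[of 6 0 2 0 1 1] in simp_all)
  next
    case 4
    hence "n > 18 \<or> n = 5"
      using assms(1) unfolding insert_iff empty_iff by presburger
    thus ?thesis
    proof (elim disjE)
      assume "n > 18"
      thus ?thesis by (intro represented_if_mod_24[where y = 3 and d = 18, OF 4]) simp_all
    qed (use representedI[of 5 1 2 1 0 1] in simp_all)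
  qed
qed

lemma represented_4:
  assumes "n > 0" "n mod 4 \<noteq> 0"
  shows "represented 4 n"
proof -
  consider "n mod 24 \<in> {1, 2, 7, 10, 11, 14, 17, 19, 22, 23}"
    | "n mod 24 \<in> {3, 5, 6, 15, 18, 21}"
    | "n mod 24 \<in> {9}"
    | "n mod 24 \<in> {13}"
    using mod_24_cases[OF assms(2)] by auto
  thus ?thesis
  proof cases
    case 1
    thus ?thesis using assms(1) by (intro represented_if_mod_24[where y = 0 and d = 0, OF 1]) simp_all
  next
    case 2
    hence "n > 4 \<or> n = 3"
      using assms(1) unfolding insert_iff empty_iff by presburger
    thus ?thesis
    proof (elim disjE)
      assume "n > 4"
      thus ?thesis by (intro represented_if_mod_24[where y = 1 and d = 4, OF 2]) simp_all
    qed (use representedI[of 3 1 4 0 0 1] in simp_all)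
  next
    case 3
    hence "n > 16 \<or> n = 9"
      using assms(1) unfolding insert_iff empty_iff by presburger
    thus ?thesis
    proof (elim disjE)
      assume "n > 16"
      thus ?thesis by (intro represented_if_mod_24[where y = 2 and d = 16, OF 3]) simp_all
    qed (use representedI[of 9 1 4 0 0 2] in simp_all)
  next
    case 4
    hence "n > 36 \<or> n = 13"
      using assms(1) unfolding insert_iff empty_iff by presburger
    thus ?thesis
    proof (elim disjE)
      assume "n > 36"
      thus ?thesis by (intro represented_if_mod_24[where y = 3 and d = 36, OF 4]) simp_all
    qed (use representedI[of 13 1 4 1 0 2] in simp_all)
  qed
qed

lemma represented_5:
  assumes "n > 0" "n mod 4 \<noteq> 0"
  shows "represented 5 n"
proof -
  consider "n mod 24 \<in> {1, 2, 7, 10, 11, 14, 17, 19, 22, 23}"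
    | "n mod 24 \<in> {3, 6, 15}"
    | "n mod 24 \<in> {13, 18, 21}"
    | "n mod 24 \<in> {9}"
    | "n mod 24 \<in> {5}"
    using mod_24_cases[OF assms(2)] by auto
  thus ?thesis
  proof cases
    case 1
    thus ?thesis using assms(1) by (intro represented_if_mod_24[where y = 0 and d = 0, OF 1]) simp_all
  next
    case 2
    hence "n > 5 \<or> n = 3"
      using assms(1) unfolding insert_iff empty_iff by presburger
    thus ?thesis
    proof (elim disjE)
      assume "n > 5"
      thus ?thesis by (intro represented_if_mod_24[where y = 1 and d = 5, OF 2]) simp_all
    qed (use representedI[of 3 1 5 0 0 1] in simp_all)
  next
    case 3
    hence "n > 20 \<or> n = 13 \<or> n = 18"
      using assms(1) unfolding insert_iff empty_iff by presburger
    thus ?thesis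
    proof (elim disjE)
      assume "n > 20"
      thus ?thesis by (intro represented_if_mod_24[where y = 2 and d = 20, OF 3]) simp_all
    qed (use representedI[of 13 0 5 1 0 2]
        representedI[of 18 0 5 0 0 3] in simp_all)
  next
    case 4
    hence "n > 80 \<or> n = 9 \<or> n = 33 \<or> n = 57"
      using assms(1) unfolding insert_iff empty_iff by presburger
    thus ?thesis
    proof (elim disjE)
      assume "n > 80"
      thus ?thesis by (intro represented_if_mod_24[where y = 4 and d = 80, OF 4]) simp_all
    qed (use representedI[of 9 1 5 0 0 2]
        representedI[of 33 1 5 0 0 4]
        representedI[of 57 1 5 0 2 4] in simp_all)
  next
    case 5
    \<comment> \<open>For residue 5 the least y that reaches a good class is 6, hence the bound 5 *
      36 and eight exceptions.\<close>
    hence "n > 180 \<or> n = 5 \<or> n = 29 \<or> n = 53 \<or> n = 77 \<or> n = 101 \<or> n = 125 \<or> n = 149 \<or> n = 173"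
      using assms(1) unfolding insert_iff empty_iff by presburger
    thus ?thesis
    proof (elim disjE)
      assume "n > 180"
      thus ?thesis by (intro represented_if_mod_24[where y = 6 and d = 180, OF 5]) simp_all
    qed (use representedI[of 5 0 5 1 0 0]
        representedI[of 29 0 5 1 2 2]
        representedI[of 53 0 5 3 0 2]
        representedI[of 77 0 5 1 0 6]
        representedI[of 101 0 5 1 4 4]
        representedI[of 125 0 5 5 0 0]
        representedI[of 149 0 5 3 2 6]
        representedI[of 173 0 5 1 2 8] in simp_all)
  qed
qed

section \<open>The form with b = 3 and four squares\<close>

text \<open>Euler's halving: after pairing entries of equal parity, half of a^2 + b^2 is ((a +
  b)/2)^2 + ((a - b)/2)^2.\<close>

lemma four_squares_half:
  fixes a b c d n :: int
  assumes "2 * n = a^2 + b^2 + c^2 + d^2"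
  obtains a' b' c' d' where "n = a'^2 + b'^2 + c'^2 + d'^2"
proof -
  have pairs: "\<exists>a' b' c' d'. n = a'^2 + b'^2 + c'^2 + d'^2"
    if n: "2 * n = a^2 + b^2 + c^2 + d^2" and par: "even (a + b)" "even (c + d)" for a b c d
  proof -
    obtain s t where "a + b = 2 * s" "c + d = 2 * t" using par by blast
    hence bd: "b = 2 * s - a" "d = 2 * t - c" by simp_all
    have "2 * n = 2 * (s^2 + (s - a)^2 + t^2 + (t - c)^2)"
      unfolding n bd by (simp add: power2_eq_square algebra_simps)
    hence "n = s^2 + (s - a)^2 + t^2 + (t - c)^2" by simp
    thus ?thesis by blast
  qed
  have "even (a^2 + b^2 + c^2 + d^2)" using assms by (metis dvd_triv_left)
  hence "even (a + b + c + d)" by simp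
  then consider "even (a + b)" "even (c + d)" | "even (a + c)" "even (b + d)" | "even (a + d)" "even (b + c)"
    by fastforce
  thus ?thesis
    using pairs[of a b c d] pairs[of a c b d] pairs[of a d b c] assms that
    by cases (auto simp: algebra_simps)
qed

lemma hex_value_imp_four_squares:
  assumes "hex_value n"
  obtains a b c d where "n = a^2 + b^2 + c^2 + d^2"
proof -
  obtain x z w where "n = x^2 + 2 * (z^2 + z * w + w^2)" using assms unfolding hex_value_def by blast
  hence "n = x^2 + z^2 + w^2 + (z + w)^2" by (simp add: power2_eq_square algebra_simps)
  thus ?thesis by (rule that)
qed

text \<open>For multiples of 3 the identity
  \<open>3 (a\<^sup>2 + b\<^sup>2 + c\<^sup>2) = (a + b + c)\<^sup>2 + 2 (p\<^sup>2 + p q + q\<^sup>2)\<close> with \<open>p = a - b\<close>, \<open>q = b - c\<close>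
  reduces the form with \<open>b = 3\<close> to a sum of four squares.\<close>

lemma represented_3:
  assumes "n > 0" "n mod 4 \<noteq> 0" "n mod 9 \<noteq> 0"
  shows "represented 3 n"
proof (cases "n mod 3 = 0")
  case True
  then obtain k where k: "n = 3 * k" by auto
  have k0: "k > 0" using assms(1) k by simp
  have k3: "k mod 3 \<noteq> 0" and k4: "k mod 4 \<noteq> 0"
    using assms(2,3) unfolding k by presburger+
  obtain y a b c where "k = y^2 + a^2 + b^2 + c^2"
  \<comment> \<open>If k is in the excluded class 5 modulo 8, then 2k is 2 modulo 8 and is a value;
    halving its four squares returns to k.\<close>
  proof (cases "k mod 8 = 5")
    case True
    hence "(2 * k) mod 8 = 2" by presburger
    moreover have "(2 * k) mod 3 \<noteq> 0" using k3 by presburger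
    ultimately have "hex_value (2 * k)"
      using k0 by (intro hex_value_if_mod) simp_all
    thus ?thesis using hex_value_imp_four_squares four_squares_half that by metis
  next
    case False
    hence "k mod 8 = 1 \<or> k mod 8 = 2 \<or> k mod 8 = 3 \<or> k mod 8 = 6 \<or> k mod 8 = 7"
      using k4 by presburger
    hence "hex_value k"
      using k0 k3 by (intro hex_value_if_mod)
    thus ?thesis using hex_value_imp_four_squares that by metis
  qed
  hence "n = (a + b + c)^2 + 3 * y^2 + 2 * ((a - b)^2 + (a - b) * (b - c) + (b - c)^2)"
    by (simp add: k power2_eq_square algebra_simps)
  thus ?thesis by (rule representedI)
next
  case False
  define r where "r = n mod 24"
  have "r mod 3 \<noteq> 0" using False unfolding r_def by (simp add: mod_mod_cancel)
  hence "r \<in> {5, 13} \<or> r \<in> {1, 2, 7, 10, 11, 14, 17, 19, 22, 23}"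
    using mod_24_cases[OF assms(2)] unfolding r_def[symmetric] by auto
  hence "n mod 24 \<in> {5, 13} \<or> n mod 24 \<in> {1, 2, 7, 10, 11, 14, 17, 19, 22, 23}"
    unfolding r_def .
  thus ?thesis
  proof
    assume *: "n mod 24 \<in> {5, 13}"
    hence "n > 3" using assms(1) unfolding insert_iff empty_iff by presburger
    thus ?thesis by (intro represented_if_mod_24[where y = 1 and d = 3, OF *]) simp_all
  next
    assume *: "n mod 24 \<in> {1, 2, 7, 10, 11, 14, 17, 19, 22, 23}"
    show ?thesis using assms(1) by (intro represented_if_mod_24[where y = 0 and d = 0, OF *]) simp_all
  qed
qed

text \<open>The squarefree part of n is divisible by neither 4 nor 9, and multiplying all variables
  by s restores the square factor.\<close>

lemma represented_all:
  assumes b: "b \<in> {1, 2, 3, 4, 5}" and n: "n \<ge> 0"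
  shows "represented b n"
proof (cases "n = 0")
  case True
  thus ?thesis by (intro representedI[of _ 0 _ 0 0 0]) simp
next
  case False
  define k c s where "k = nat n" and "c = squarefree_part k" and "s = square_part k"
  have k: "n = int k" "k > 0" using n False by (simp_all add: k_def)
  have kcs: "k = c * s^2" unfolding c_def s_def by (rule squarefree_decompose)
  have sqf: "squarefree c" unfolding c_def by (rule squarefree_squarefree_part)
  have "\<not> 2^2 dvd c" "\<not> 3^2 dvd c"
    using squarefreeD[OF sqf, of 2] squarefreeD[OF sqf, of 3] by auto
  hence "int c mod 4 \<noteq> 0" "int c mod 9 \<noteq> 0"
    by (simp_all add: mod_eq_0_iff_dvd) presburger+
  moreover have "int c > 0" using k kcs by (auto intro!: Nat.gr0I)
  ultimately have "represented b (int c)"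
    using b represented_1 represented_2 represented_3 represented_4 represented_5 by auto
  then obtain x y z w where "int c = x^2 + b * y^2 + 2 * (z^2 + z * w + w^2)"
    unfolding represented_def by blast
  hence "n = (int s * x)^2 + b * (int s * y)^2
      + 2 * ((int s * z)^2 + (int s * z) * (int s * w) + (int s * w)^2)"
    by (simp add: k kcs power2_eq_square algebra_simps)
  thus ?thesis by (rule representedI)
qed

section \<open>Necessity\<close>

lemma hexagonal_norm_nonneg: "z^2 + z * w + w^2 \<ge> (0::int)"
proof -
  have "4 * (z^2 + z * w + w^2) = (2 * z + w)^2 + 3 * w^2"
    by (simp add: power2_eq_square algebra_simps)
  also have "\<dots> \<ge> 0" by simp
  finally show ?thesis by (simp add: zero_le_mult_iff)
qed

text \<open>The prime 2 is inert in the Eisenstein integers: an even norm forces z and w even, hence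
  divisibility by 4.\<close>

lemma hexagonal_norm_neq_2: "z^2 + z * w + w^2 \<noteq> (2::int)"
proof
  assume *: "z^2 + z * w + w^2 = 2"
  hence "even (z^2 + z * w + w^2)" by simp
  hence "even z" "even w" by auto
  then obtain z' w' where "z = 2 * z'" "w = 2 * w'" by blast
  hence "4 * (z'^2 + z' * w' + w'^2) = 2" using * by (simp add: power2_eq_square algebra_simps)
  thus False by presburger
qed

lemma coefficient_mult_square_ge:
  fixes a x :: int
  assumes "a \<ge> 0" "x \<noteq> 0"
  shows "a \<le> a * x^2"
proof -
  have "x^2 \<ge> 1" using assms(2) by (simp add: int_one_le_iff_zero_less)
  thus ?thesis using mult_left_mono[of 1 "x^2" a] assms(1) by simp
qed

theorem theorem4p1:
  fixes a b :: int
  assumes "1 \<le> a" and "a \<le> b"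
  shows "(\<forall>n::int. n \<ge> 0 \<longrightarrow>
            (\<exists>x y z w :: int. n = a * x^2 + b * y^2 + 2 * (z^2 + z * w + w^2)))
         \<longleftrightarrow> (a = 1 \<and> b \<in> {1, 2, 3, 4, 5})"
proof
  assume universal: "\<forall>n::int. n \<ge> 0 \<longrightarrow>
    (\<exists>x y z w :: int. n = a * x^2 + b * y^2 + 2 * (z^2 + z * w + w^2))"
  have a: "a = 1"
  proof (rule ccontr)
    assume "a \<noteq> 1"
    obtain x y z w where eq: "1 = a * x^2 + b * y^2 + 2 * (z^2 + z * w + w^2)"
      using universal by (metis zero_le_one)
    define h where "h = z^2 + z * w + w^2"
    have nonneg: "a * x^2 \<ge> 0" "b * y^2 \<ge> 0" "h \<ge> 0"
      using assms hexagonal_norm_nonneg by (simp_all add: h_def)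
    have eq': "1 = a * x^2 + b * y^2 + 2 * h" using eq by (simp add: h_def)
    have "x = 0"
    proof (rule ccontr)
      assume "x \<noteq> 0"
      hence "a \<le> a * x^2" using assms by (intro coefficient_mult_square_ge) auto
      thus False using nonneg eq' assms \<open>a \<noteq> 1\<close> by linarith
    qed
    moreover have "y = 0"
    proof (rule ccontr)
      assume "y \<noteq> 0"
      hence "b \<le> b * y^2" using assms by (intro coefficient_mult_square_ge) auto
      thus False using nonneg eq' assms \<open>a \<noteq> 1\<close> by linarith
    qed
    ultimately have "1 = 2 * h" using eq' by simp
    thus False by presburger
  qed
  \<comment> \<open>If b >= 6, then 5 must be x^2 + 2h; parity forces x^2 = 1 and h = 2, which is
    not a norm.\<close>
  have "b \<le> 5"
  proof (rule ccontr)
    assume b: "\<not> b \<le> 5"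
    obtain x y z w where eq: "5 = a * x^2 + b * y^2 + 2 * (z^2 + z * w + w^2)"
      using universal by (metis zero_le_numeral)
    define h where "h = z^2 + z * w + w^2"
    have h: "h \<ge> 0" "h \<noteq> 2" unfolding h_def by (rule hexagonal_norm_nonneg, rule hexagonal_norm_neq_2)
    have x2: "x^2 \<ge> 0" by simp
    have eq': "5 = x^2 + b * y^2 + 2 * h" using eq by (simp add: a h_def)
    have "y = 0"
    proof (rule ccontr)
      assume "y \<noteq> 0"
      hence "b \<le> b * y^2" using b by (intro coefficient_mult_square_ge) auto
      thus False using h(1) x2 eq' b by linarith
    qed
    hence x: "5 = x^2 + 2 * h" using eq' by simp
    have "\<bar>x\<bar> < 3"
    proof (rule ccontr)
      assume "\<not> \<bar>x\<bar> < 3"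
      hence "3^2 \<le> \<bar>x\<bar>^2" by (intro power_mono) auto
      thus False using x h(1) by simp
    qed
    hence "x^2 = 0 \<or> x^2 = 1 \<or> x^2 = 4"
    proof -
      assume "\<bar>x\<bar> < 3"
      hence "x = -2 \<or> x = -1 \<or> x = 0 \<or> x = 1 \<or> x = 2" by presburger
      thus ?thesis by auto
    qed
    thus False using x h(2) by presburger
  qed
  thus "a = 1 \<and> b \<in> {1, 2, 3, 4, 5}" using a assms by auto
next
  assume "a = 1 \<and> b \<in> {1, 2, 3, 4, 5}"
  hence "a = 1" "\<And>n. n \<ge> 0 \<Longrightarrow> represented b n" using represented_all by blast+
  thus "\<forall>n::int. n \<ge> 0 \<longrightarrow>
    (\<exists>x y z w :: int. n = a * x^2 + b * y^2 + 2 * (z^2 + z * w + w^2))"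
    unfolding represented_def by simp
qed

end
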